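(* For each $n$ let $N=\binom n2$, let $\alpha=(\alpha_e)_{e\in E_n}$ be a vector of positive reals, and let $G_{\Sigma,p}$ be the random graph on $[n]$ defined by a uniform random point of the simplex $\Sigma=\{X\in\mathbb{R}_+^N:\sum_{e\in E_n}\alpha_eX_e\le N\}$. (a) Let $p=\frac{\ln n+c_n}{n}$. If $\alpha=\mathbf{1}$ (i.e. $\alpha_e=1$ for all $e\in E_n$), then $$\lim_{n\to\infty}\Pr(G_{\Sigma,p}\text{ is connected})=\begin{cases}0 & c_n\to-\infty,\\ e^{-e^{-c}} & c_n\to c,\\ 1 & c_n\to\infty.\end{cases}$$ (b) Suppose that $\alpha$ is $M$-bounded, where $M=M(n)\le(\ln n)^{1/4}$. Let $p_0$ be the solution to $$\sum_{v\in[n]}\xi_v(p)=1,\qquad\text{where }\ \xi_v(p)=\Bigl(1-\frac{\alpha_vp}{N}\Bigr)^N .$$ Then for any fixed $\varepsilon>0$, $$\lim_{n\to\infty}\Pr(G_{\Sigma,p}\text{ is connected})=\begin{cases}0 & p\le(1-\varepsilon)p_0,\\ 1 & p\ge(1+\varepsilon)p_0.\end{cases}$$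
   Context: $[n]=\{1,\dots,n\}$ and $E_n=\binom{[n]}{2}$ is the set of unordered pairs of vertices, so $|E_n|=N$. Given $\alpha$ with $\alpha_e>0$, choose $X$ uniformly at random from $\Sigma$; $G_{\Sigma,p}$ is the graph with vertex set $[n]$ whose edges are the pairs $e$ with $X_e\le p$. The vector $\alpha$ is $M$-bounded if $1/M\le\alpha_e\le M$ for all $e\in E_n$. For $v\in[n]$, $\alpha_v=\sum_{w\ne v}\alpha_{vw}$. In the equation defining $p_0$, $p$ ranges over values with $0\le\alpha_vp\le N$ for all $v$ (where $\xi_v(p)$ is the probability that $v$ is isolated in $G_{\Sigma,p}$). *)

theory Defs
  imports "HOL-Probability.Probability"
begin

definition edge_set :: "nat \<Rightarrow> nat set set" where
  "edge_set n = {e. e \<subseteq> {1..n} \<and> card e = 2}"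

definition simplex_Sigma :: "nat \<Rightarrow> (nat set \<Rightarrow> real) \<Rightarrow> (nat set \<Rightarrow> real) set" where
  "simplex_Sigma n \<alpha> = {X \<in> edge_set n \<rightarrow>\<^sub>E {0..}. (\<Sum>e\<in>edge_set n. \<alpha> e * X e) \<le> real (n choose 2)}"

text \<open>The space of real vectors indexed by the edges is the extensional function space carrying
  the product of Lebesgue measures.\<close>

definition uniform_Sigma :: "nat \<Rightarrow> (nat set \<Rightarrow> real) \<Rightarrow> (nat set \<Rightarrow> real) measure" where
  "uniform_Sigma n \<alpha> = uniform_measure (\<Pi>\<^sub>M e\<in>edge_set n. lborel) (simplex_Sigma n \<alpha>)"

definition threshold_edges :: "nat \<Rightarrow> real \<Rightarrow> (nat set \<Rightarrow> real) \<Rightarrow> nat set set" where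
  "threshold_edges n p X = {e \<in> edge_set n. X e \<le> p}"

definition graph_connected :: "'a set \<Rightarrow> 'a set set \<Rightarrow> bool" where
  "graph_connected V F \<longleftrightarrow> (\<forall>u\<in>V. \<forall>v\<in>V. (u, v) \<in> {(a, b). {a, b} \<in> F}\<^sup>*)"

definition prob_connected :: "nat \<Rightarrow> (nat set \<Rightarrow> real) \<Rightarrow> real \<Rightarrow> real" where
  "prob_connected n \<alpha> p =
     \<P>(X in uniform_Sigma n \<alpha>. graph_connected {1..n} (threshold_edges n p X))"

definition M_bounded :: "real \<Rightarrow> nat \<Rightarrow> (nat set \<Rightarrow> real) \<Rightarrow> bool" where
  "M_bounded M n \<alpha> \<longleftrightarrow> (\<forall>e\<in>edge_set n. 1 / M \<le> \<alpha> e \<and> \<alpha> e \<le> M)"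

definition vertex_weight :: "nat \<Rightarrow> (nat set \<Rightarrow> real) \<Rightarrow> nat \<Rightarrow> real" where
  "vertex_weight n \<alpha> v = (\<Sum>w\<in>{1..n} - {v}. \<alpha> {v, w})"

definition xi :: "nat \<Rightarrow> (nat set \<Rightarrow> real) \<Rightarrow> nat \<Rightarrow> real \<Rightarrow> real" where
  "xi n \<alpha> v p = (1 - vertex_weight n \<alpha> v * p / real (n choose 2)) ^ (n choose 2)"

text \<open>For positive weights and \<open>n \<ge> 2\<close> the sum below is strictly decreasing in \<open>p\<close> on the admissible
  range, so there is at most one solution; under the boundedness hypothesis of the theorem a
  solution exists for all large \<open>n\<close>. For the remaining \<open>n\<close> the value may be unspecified.\<close>

definition p0 :: "nat \<Rightarrow> (nat set \<Rightarrow> real) \<Rightarrow> real" where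
  "p0 n \<alpha> = (THE p. (\<forall>v\<in>{1..n}. 0 \<le> vertex_weight n \<alpha> v * p \<and>
                                vertex_weight n \<alpha> v * p \<le> real (n choose 2)) \<and>
                    (\<Sum>v\<in>{1..n}. xi n \<alpha> v p) = 1)"

end

(*
  The probability that no edge of S is present at time p is the volume of a corner of the simplex,
  again a simplex, relative to the whole: it equals (1 - alpha(S) p / N)_+^N. Everything else
  follows from this formula.

  A graph is disconnected iff some set of at most n/2 vertices has an empty boundary. For
  alpha = 1, exact inclusion-exclusion and Tannery's theorem give the probability that no vertex is
  isolated, and a union bound over the larger sets (which must contain an edge) is negligible;
  monotonicity in p reduces arbitrary windows c_n to constant ones. For bounded weights, above
  the threshold the union bound over all sets already tends to 0, and below the threshold
  Chebyshev's inequality yields an isolated vertex.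
*)
theory Submission
  imports Defs "HOL-Real_Asymp.Real_Asymp"
begin

section \<open>Volumes of corner simplices\<close>

text \<open>The coordinates of X are dependent, yet the absence of an edge set S depends only on its
  total weight: forcing X_e above p on S moves the corner and leaves the budget N - alpha(S) p, and
  volume is homogeneous of degree N. With t = alpha(S) p the resulting power is at most exp(-t), and
  at least exp(-t - 2 t^2 / N) for t <= N / 2, so edges behave almost independently while t^2 is
  o(N). In the critical window the plain union bound is too weak: its term for sets of k vertices
  tends to exp(-c)^k / k!, mostly because k isolated vertices also have an empty boundary. The edge
  inside the set contributes a further factor of order p, and this makes the term vanish. For
  bounded weights the exponent 1/4 enters as M^2 <= sqrt (ln n). One factor M is lost in estimating
  p0 and one in the degree, so the weighted degrees at p0 lie between about sqrt (ln n) and (ln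
  n)^(3/2). The lower end tends to infinity, so a factor 1 - epsilon or 1 + epsilon drives the
  expected number of isolated vertices to infinity or to 0; the upper end is negligible against
  N.\<close>

lemma PiM_lborel_affine:
  fixes a s :: "'i \<Rightarrow> real"
  assumes [simp]: "finite I" and a: "\<And>i. i \<in> I \<Longrightarrow> 0 < a i"
  shows "(\<Pi>\<^sub>M i\<in>I. lborel) = scale_measure (ennreal (\<Prod>i\<in>I. a i))
           (distr (\<Pi>\<^sub>M i\<in>I. lborel) (\<Pi>\<^sub>M i\<in>I. lborel) (\<lambda>X. \<lambda>i\<in>I. s i + a i * X i))"
    (is "?M = ?R")
proof -
  interpret product_sigma_finite "\<lambda>_. lborel :: real measure" by standard
  let ?T = "\<lambda>X. \<lambda>i\<in>I. s i + a i * X i"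
  have T: "?T \<in> measurable ?M ?M" by measurable
  \<comment> \<open>A product measure is determined by its values on boxes, and the preimage of a
    box under a coordinatewise affine map is a box. The claim thus splits into one-dimensional
    changes of variables.\<close>
  have "?R = ?M"
  proof (rule PiM_eqI)
    fix A :: "'i \<Rightarrow> real set" assume A: "\<And>i. i \<in> I \<Longrightarrow> A i \<in> sets lborel"
    have vim: "(\<lambda>x. s i + a i * x) -` A i \<in> sets lborel" if "i \<in> I" for i
    proof -
      have "(\<lambda>x. s i + a i * x) -` A i \<inter> space lborel \<in> sets lborel"
        by (rule measurable_sets[OF _ A[OF that]]) measurable
      then show ?thesis by simp
    qed
    have em: "emeasure lborel (A i) = ennreal (a i) * emeasure lborel ((\<lambda>x. s i + a i * x) -` A i)"
      if "i \<in> I" for i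
    proof -
      have "emeasure lborel (A i) =
          emeasure (density (distr lborel borel (\<lambda>x. s i + a i * x)) (\<lambda>_. ennreal \<bar>a i\<bar>)) (A i)"
        using a[OF that] by (subst lborel_real_affine[of "a i" "s i"]) auto
      also have "\<dots> = ennreal (a i) * emeasure (distr lborel borel (\<lambda>x. s i + a i * x)) (A i)"
        using a[OF that] A[OF that] by (subst emeasure_density_const) auto
      also have "\<dots> = ennreal (a i) * emeasure lborel ((\<lambda>x. s i + a i * x) -` A i)"
        using A[OF that] by (subst emeasure_distr) auto
      finally show ?thesis .
    qed
    have pre: "?T -` Pi\<^sub>E I A \<inter> space ?M = Pi\<^sub>E I (\<lambda>i. (\<lambda>x. s i + a i * x) -` A i)"
      by (auto simp: space_PiM PiE_iff extensional_def)
    have "Pi\<^sub>E I A \<in> sets ?M" using A by (intro sets_PiM_I_finite) auto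
    then have "emeasure ?R (Pi\<^sub>E I A) = ennreal (\<Prod>i\<in>I. a i) *
        emeasure ?M (Pi\<^sub>E I (\<lambda>i. (\<lambda>x. s i + a i * x) -` A i))"
      using T by (simp add: emeasure_distr pre)
    also have "\<dots> = (\<Prod>i\<in>I. ennreal (a i)) * (\<Prod>i\<in>I. emeasure lborel ((\<lambda>x. s i + a i * x) -` A i))"
      using vim a by (subst emeasure_PiM) (auto simp: prod_ennreal less_imp_le)
    also have "\<dots> = (\<Prod>i\<in>I. emeasure lborel (A i))"
      by (simp add: em prod.distrib)
    finally show "emeasure ?R (Pi\<^sub>E I A) = (\<Prod>i\<in>I. emeasure lborel (A i))" .
  qed simp_all
  then show ?thesis ..
qed

text \<open>One shape serves twice: \<open>s = 0\<close> gives the whole simplex, and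
  \<open>s = p\<close> on a set of edges gives the event that they are all late.\<close>

definition corner_simplex :: "'i set \<Rightarrow> ('i \<Rightarrow> real) \<Rightarrow> ('i \<Rightarrow> real) \<Rightarrow> real \<Rightarrow> ('i \<Rightarrow> real) set" where
  "corner_simplex I a s t = {X \<in> extensional I. (\<forall>i\<in>I. s i \<le> X i) \<and> (\<Sum>i\<in>I. a i * X i) \<le> t}"

lemma sets_corner_simplex [measurable]:
  assumes [simp]: "finite I"
  shows "corner_simplex I a s t \<in> sets (\<Pi>\<^sub>M i\<in>I. (lborel :: real measure))"
proof -
  have "corner_simplex I a s t = {X \<in> space (\<Pi>\<^sub>M i\<in>I. (lborel :: real measure)).
      (\<forall>i\<in>I. s i \<le> X i) \<and> (\<Sum>i\<in>I. a i * X i) \<le> t}"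
    by (auto simp: corner_simplex_def space_PiM PiE_def)
  also have "\<dots> \<in> sets (\<Pi>\<^sub>M i\<in>I. lborel)" by measurable
  finally show ?thesis .
qed

text \<open>The substitution \<open>X i = s i + Y i / a i\<close> turns the set into the standard
  simplex of size \<open>u = t - (\<Sum>i\<in>I. a i * s i)\<close>, of volume
  \<open>u ^ card I / fact (card I)\<close>, with Jacobian \<open>1 / (\<Prod>i\<in>I. a i)\<close>.
  For negative \<open>u\<close> the set is empty, and \<open>I \<noteq> {}\<close> makes the power
  of 0 vanish.\<close>

lemma emeasure_corner_simplex:
  fixes a s :: "'i \<Rightarrow> real"
  assumes I [simp]: "finite I" "I \<noteq> {}" and a: "\<And>i. i \<in> I \<Longrightarrow> 0 < a i"
  shows "emeasure (\<Pi>\<^sub>M i\<in>I. lborel) (corner_simplex I a s t) =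
    ennreal (max 0 (t - (\<Sum>i\<in>I. a i * s i)) ^ card I / (fact (card I) * (\<Prod>i\<in>I. a i)))"
proof (cases "t < (\<Sum>i\<in>I. a i * s i)")
  case True
  have "(\<Sum>i\<in>I. a i * s i) \<le> (\<Sum>i\<in>I. a i * X i)" if "X \<in> corner_simplex I a s t" for X
    using that a by (intro sum_mono mult_left_mono) (auto simp: corner_simplex_def less_imp_le)
  then have "corner_simplex I a s t = {}"
    using True by (force simp: corner_simplex_def)
  then show ?thesis using True by (simp add: zero_power card_gt_0_iff)
next
  case False
  let ?M = "\<Pi>\<^sub>M i\<in>I. (lborel :: real measure)"
  let ?T = "\<lambda>X. \<lambda>i\<in>I. s i + (1 / a i) * X i"
  define u where "u = t - (\<Sum>i\<in>I. a i * s i)"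
  have u: "u \<ge> 0" using False by (simp add: u_def)
  have sm: "(\<Sum>i\<in>I. a i * (s i + X i / a i)) = (\<Sum>i\<in>I. a i * s i) + sum X I" for X
    unfolding sum.distrib[symmetric]
    by (rule sum.cong) (use a in \<open>auto simp: field_simps\<close>, metis less_irrefl)
  have nn: "s i \<le> s i + x / a i \<longleftrightarrow> 0 \<le> x" if "i \<in> I" for i x
    using a[OF that] by (simp add: zero_le_divide_iff)
  have pre: "?T -` corner_simplex I a s t \<inter> space ?M =
      {X. (\<forall>i\<in>I. 0 \<le> X i) \<and> sum X I \<le> u} \<inter> space ?M"
    by (auto simp: corner_simplex_def u_def sm nn simp del: le_add_same_cancel1)
  have T: "?T \<in> measurable ?M ?M" by measurable
  have "emeasure ?M (corner_simplex I a s t) =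
      emeasure (scale_measure (ennreal (\<Prod>i\<in>I. 1 / a i)) (distr ?M ?M ?T)) (corner_simplex I a s t)"
    using a by (subst PiM_lborel_affine[of I "\<lambda>i. 1 / a i" s]) auto
  also have "\<dots> = ennreal (\<Prod>i\<in>I. 1 / a i) * emeasure ?M (?T -` corner_simplex I a s t \<inter> space ?M)"
    using T by (simp add: emeasure_distr sets_corner_simplex)
  also have "\<dots> = ennreal (\<Prod>i\<in>I. 1 / a i) * ennreal (u ^ card I / fact (card I))"
    unfolding pre using u by (subst emeasure_std_simplex_aux) auto
  also have "\<dots> = ennreal ((\<Prod>i\<in>I. 1 / a i) * (u ^ card I / fact (card I)))"
    using u by (subst ennreal_mult'') auto
  also have "(\<Prod>i\<in>I. 1 / a i) = 1 / (\<Prod>i\<in>I. a i)" by (simp add: prod_dividef)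
  finally show ?thesis using u False by (simp add: u_def max_def field_simps)
qed


section \<open>Probabilities of missing edges in the random graph\<close>

lemma finite_edge_set [simp]: "finite (edge_set n)"
  by (rule finite_subset[of _ "Pow {1..n}"]) (auto simp: edge_set_def)

lemma card_edge_set: "card (edge_set n) = n choose 2"
  using n_subsets[of "{1..n}" 2] by (simp add: edge_set_def)

lemma simplex_Sigma_eq: "simplex_Sigma n \<alpha> = corner_simplex (edge_set n) \<alpha> (\<lambda>_. 0) (real (n choose 2))"
  by (auto simp: simplex_Sigma_def corner_simplex_def PiE_def)

text \<open>The argument \<open>t\<close> is the total weight of the missing edges times
  \<open>p\<close>. The truncation matters: for \<open>t > N\<close> the event is impossible, while
  the plain power would be nonzero for \<open>t > N\<close>.\<close>

definition empty_prob :: "nat \<Rightarrow> real \<Rightarrow> real" where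
  "empty_prob N t = max 0 (1 - t / real N) ^ N"

locale simplex_graph =
  fixes n :: nat and \<alpha> :: "nat set \<Rightarrow> real"
  assumes n2: "2 \<le> n" and pos: "\<And>e. e \<in> edge_set n \<Longrightarrow> 0 < \<alpha> e"
begin

abbreviation "N \<equiv> n choose 2"
abbreviation "L \<equiv> \<Pi>\<^sub>M e\<in>edge_set n. (lborel :: real measure)"
abbreviation "U \<equiv> uniform_Sigma n \<alpha>"

lemma N_pos: "0 < N"
  using n2 by (simp add: zero_less_binomial_iff)

lemma edge_set_nonempty: "edge_set n \<noteq> {}"
  using N_pos card_edge_set[of n] by auto

lemma prod_pos_weights: "0 < (\<Prod>e\<in>edge_set n. \<alpha> e)"
  using pos by (simp add: prod_pos)

lemma emeasure_corner_simplex_edges: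
  "emeasure L (corner_simplex (edge_set n) \<alpha> s t) =
    ennreal (max 0 (t - (\<Sum>e\<in>edge_set n. \<alpha> e * s e)) ^ N / (fact N * (\<Prod>e\<in>edge_set n. \<alpha> e)))"
  unfolding card_edge_set[symmetric]
  by (rule emeasure_corner_simplex[OF finite_edge_set edge_set_nonempty]) (rule pos)

lemma measure_corner_simplex:
  "measure L (corner_simplex (edge_set n) \<alpha> s t) =
    max 0 (t - (\<Sum>e\<in>edge_set n. \<alpha> e * s e)) ^ N / (fact N * (\<Prod>e\<in>edge_set n. \<alpha> e))"
    (is "_ = ?r")
proof -
  have "0 \<le> ?r"
    using prod_pos_weights by (intro divide_nonneg_nonneg mult_nonneg_nonneg zero_le_power) auto
  then show ?thesis
    unfolding measure_def emeasure_corner_simplex_edges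
    by (rule enn2real_ennreal)
qed

lemma emeasure_simplex_Sigma:
  "emeasure L (simplex_Sigma n \<alpha>) \<noteq> 0" "emeasure L (simplex_Sigma n \<alpha>) \<noteq> \<infinity>"
proof -
  let ?v = "real N ^ N / (fact N * (\<Prod>e\<in>edge_set n. \<alpha> e))"
  have "0 < ?v"
    using N_pos prod_pos_weights by (intro divide_pos_pos mult_pos_pos zero_less_power) auto
  moreover have "emeasure L (simplex_Sigma n \<alpha>) = ennreal ?v"
    unfolding simplex_Sigma_eq emeasure_corner_simplex_edges
    by simp
  ultimately show "emeasure L (simplex_Sigma n \<alpha>) \<noteq> 0" "emeasure L (simplex_Sigma n \<alpha>) \<noteq> \<infinity>"
    by (metis ennreal_eq_0_iff not_le, metis ennreal_neq_top infinity_ennreal_def)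
qed

sublocale prob_space U
  unfolding uniform_Sigma_def by (intro prob_space_uniform_measure emeasure_simplex_Sigma)

lemma sets_U [measurable_cong]: "sets U = sets L"
  by (simp add: uniform_Sigma_def)

lemma space_U: "space U = space L"
  by (simp add: uniform_Sigma_def)

lemma simplex_Sigma_sets [measurable]: "simplex_Sigma n \<alpha> \<in> sets L"
  by (simp add: simplex_Sigma_eq sets_corner_simplex)

lemma prob_U: "A \<in> sets L \<Longrightarrow> prob A = measure L (simplex_Sigma n \<alpha> \<inter> A) / measure L (simplex_Sigma n \<alpha>)"
  using emeasure_simplex_Sigma by (simp add: uniform_Sigma_def)

text \<open>The threshold graph takes finitely many values, and each fibre is a finite combination
  of conditions on single coordinates. Hence every graph property is measurable.\<close>

lemma sets_threshold [measurable]: "{X \<in> space U. Q (threshold_edges n p X)} \<in> sets U"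
proof -
  have F: "threshold_edges n p X = F \<longleftrightarrow> (\<forall>e\<in>edge_set n. X e \<le> p \<longleftrightarrow> e \<in> F)"
    if "F \<subseteq> edge_set n" for X F
    using that unfolding threshold_edges_def by blast
  have sub: "threshold_edges n p X \<subseteq> edge_set n" for X
    by (auto simp: threshold_edges_def)
  have "{X \<in> space U. Q (threshold_edges n p X)} =
      (\<Union>F\<in>{F. F \<subseteq> edge_set n \<and> Q F}. {X \<in> space U. threshold_edges n p X = F})"
    using sub by blast
  also have "\<dots> = (\<Union>F\<in>{F. F \<subseteq> edge_set n \<and> Q F}.
      {X \<in> space U. \<forall>e\<in>edge_set n. X e \<le> p \<longleftrightarrow> e \<in> F})"
    by (rule SUP_cong) (simp_all add: F)
  also have "\<dots> \<in> sets U"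
  proof (rule sets.finite_UN)
    show "finite {F. F \<subseteq> edge_set n \<and> Q F}" by simp
    show "{X \<in> space U. \<forall>e\<in>edge_set n. X e \<le> p \<longleftrightarrow> e \<in> F} \<in> sets U" for F
      unfolding space_U sets_U by measurable
  qed
  finally show ?thesis .
qed

text \<open>As \<open>0 \<le> p\<close>, the lower bounds on \<open>S\<close> imply nonnegativity
  there, so the event cuts a corner simplex out of the simplex. In the ratio of volumes the
  factorial and the product of the weights cancel.\<close>

lemma prob_ge:
  assumes "S \<subseteq> edge_set n" "0 \<le> p"
  shows "\<P>(X in U. \<forall>e\<in>S. p \<le> X e) = empty_prob N (sum \<alpha> S * p)"
proof -
  have fin: "finite S" using finite_subset[OF assms(1)] by simp
  have A: "{X \<in> space U. \<forall>e\<in>S. p \<le> X e} \<in> sets L"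
    unfolding space_U using fin by (measurable, use assms(1) in auto)
  have eq: "simplex_Sigma n \<alpha> \<inter> {X \<in> space U. \<forall>e\<in>S. p \<le> X e} =
      corner_simplex (edge_set n) \<alpha> (\<lambda>e. if e \<in> S then p else 0) (real N)"
    using assms by (auto simp: simplex_Sigma_eq corner_simplex_def space_U space_PiM PiE_def split: if_splits
        intro: order_trans)
  have s: "(\<Sum>e\<in>edge_set n. \<alpha> e * (if e \<in> S then p else 0)) = sum \<alpha> S * p"
    using assms(1) by (simp add: if_distrib sum.If_cases Int_absorb1 sum_distrib_right cong: if_cong)
  have "\<P>(X in U. \<forall>e\<in>S. p \<le> X e) = max 0 (real N - sum \<alpha> S * p) ^ N / real N ^ N"
    unfolding prob_U[OF A] eq
    unfolding simplex_Sigma_eq measure_corner_simplex s using less_imp_neq[OF prod_pos_weights]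
    by (simp del: prod_zero_iff)
  also have "\<dots> = (max 0 (real N - sum \<alpha> S * p) / real N) ^ N"
    by (simp add: power_divide)
  also have "max 0 (real N - sum \<alpha> S * p) / real N = max 0 (1 - sum \<alpha> S * p / real N)"
    using N_pos by (auto simp: max_def field_simps)
  finally show ?thesis by (simp add: empty_prob_def)
qed

text \<open>The strict inequality is squeezed between the non-strict ones at \<open>p\<close> and at
  \<open>p' > p\<close>, with \<open>p' \<rightarrow> p\<close>.\<close>
lemma prob_no_edges:
  assumes "S \<subseteq> edge_set n" "0 \<le> p"
  shows "\<P>(X in U. S \<inter> threshold_edges n p X = {}) = empty_prob N (sum \<alpha> S * p)"
proof (rule antisym)
  have fin: "finite S" using finite_subset[OF assms(1)] by simp
  have ev: "{X \<in> space U. S \<inter> threshold_edges n p X = {}} = {X \<in> space U. \<forall>e\<in>S. p < X e}"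
    using assms(1) by (force simp: threshold_edges_def)
  have m: "{X \<in> space U. \<forall>e\<in>S. r \<le> X e} \<in> sets U" for r
    unfolding space_U sets_U using fin by (measurable, use assms(1) in auto)
  show "\<P>(X in U. S \<inter> threshold_edges n p X = {}) \<le> empty_prob N (sum \<alpha> S * p)"
    unfolding prob_ge[OF assms, symmetric] ev by (rule finite_measure_mono[OF _ m]) auto
  have "((\<lambda>r. empty_prob N (sum \<alpha> S * r)) \<longlongrightarrow> empty_prob N (sum \<alpha> S * p)) (at_right p)"
    unfolding empty_prob_def using N_pos by (intro tendsto_intros) auto
  moreover have "\<forall>\<^sub>F r in at_right p. empty_prob N (sum \<alpha> S * r) \<le>
      \<P>(X in U. S \<inter> threshold_edges n p X = {})"
    using eventually_at_right_less
  proof eventually_elim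
    case (elim r)
    have "empty_prob N (sum \<alpha> S * r) = \<P>(X in U. \<forall>e\<in>S. r \<le> X e)"
      using assms elim by (subst prob_ge) auto
    also have "\<dots> \<le> \<P>(X in U. S \<inter> threshold_edges n p X = {})"
      using elim sets_threshold[of "\<lambda>F. S \<inter> F = {}" p] by (intro finite_measure_mono) (auto simp: ev)
    finally show ?case .
  qed
  ultimately show "empty_prob N (sum \<alpha> S * p) \<le> \<P>(X in U. S \<inter> threshold_edges n p X = {})"
    by (rule tendsto_upperbound) simp
qed

end

section \<open>Edge cuts\<close>

definition edge_cut :: "nat \<Rightarrow> nat set \<Rightarrow> nat set set" where
  "edge_cut n S = {e \<in> edge_set n. e \<inter> S \<noteq> {} \<and> \<not> e \<subseteq> S}"

lemma cut_subset: "edge_cut n S \<subseteq> edge_set n"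
  by (auto simp: edge_cut_def)

lemma finite_cut [simp]: "finite (edge_cut n S)"
  by (rule finite_subset[OF cut_subset]) simp

lemma edge_set_iff: "{v, w} \<in> edge_set n \<longleftrightarrow> v \<noteq> w \<and> v \<in> {1..n} \<and> w \<in> {1..n}"
  by (auto simp: edge_set_def card_insert_if)

lemma edge_setE:
  assumes "e \<in> edge_set n"
  obtains v w where "e = {v, w}" "v \<noteq> w" "v \<in> {1..n}" "w \<in> {1..n}"
  using assms by (auto simp: edge_set_def card_2_iff)

lemma cut_eq_image:
  assumes "S \<subseteq> {1..n}"
  shows "edge_cut n S = (\<lambda>(v, w). {v, w}) ` (S \<times> ({1..n} - S))"
proof
  show "edge_cut n S \<subseteq> (\<lambda>(v, w). {v, w}) ` (S \<times> ({1..n} - S))"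
  proof
    fix e assume e: "e \<in> edge_cut n S"
    then obtain v w where "e = {v, w}" "v \<noteq> w" "v \<in> {1..n}" "w \<in> {1..n}"
      using cut_subset edge_setE by blast
    then consider "e = {v, w}" "v \<in> S" "w \<in> {1..n} - S" | "e = {w, v}" "w \<in> S" "v \<in> {1..n} - S"
      using e by (auto simp: edge_cut_def)
    then show "e \<in> (\<lambda>(v, w). {v, w}) ` (S \<times> ({1..n} - S))"
      by cases blast+
  qed
  show "(\<lambda>(v, w). {v, w}) ` (S \<times> ({1..n} - S)) \<subseteq> edge_cut n S"
  proof clarify
    fix v w assume "v \<in> S" "w \<in> {1..n}" "w \<notin> S"
    moreover from this assms have "v \<noteq> w" "v \<in> {1..n}" by auto
    ultimately show "{v, w} \<in> edge_cut n S" by (simp add: edge_cut_def edge_set_iff)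
  qed
qed

lemma inj_on_cut: "inj_on (\<lambda>(v, w). {v, w}) (S \<times> (T - S))"
  by (auto simp: inj_on_def doubleton_eq_iff)

lemma sum_cut:
  fixes f :: "nat set \<Rightarrow> real"
  assumes "S \<subseteq> {1..n}"
  shows "sum f (edge_cut n S) = (\<Sum>v\<in>S. \<Sum>w\<in>{1..n} - S. f {v, w})"
  by (simp only: cut_eq_image[OF assms] sum.reindex[OF inj_on_cut] sum.cartesian_product)
    (simp add: case_prod_unfold)

lemma card_cut:
  assumes "S \<subseteq> {1..n}"
  shows "card (edge_cut n S) = card S * (n - card S)"
  using assms finite_subset[OF assms]
  by (simp add: cut_eq_image[OF assms] card_image[OF inj_on_cut] card_Diff_subset)

lemma vertex_weight_eq: "v \<in> {1..n} \<Longrightarrow> vertex_weight n \<alpha> v = sum \<alpha> (edge_cut n {v})"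
  by (simp add: vertex_weight_def sum_cut)

lemma cut_singleton: "v \<in> {1..n} \<Longrightarrow> edge_cut n {v} = {e \<in> edge_set n. v \<in> e}"
  unfolding edge_cut_def edge_set_def by (auto dest!: subset_singletonD)

text \<open>The stars of \<open>v\<close> and \<open>w\<close> share exactly the edge
  \<open>{v, w}\<close>, which would otherwise be counted twice.\<close>

lemma sum_cut_pair:
  assumes "v \<in> {1..n}" "w \<in> {1..n}" "v \<noteq> w"
  shows "sum \<alpha> (edge_cut n {v} \<union> edge_cut n {w}) =
    vertex_weight n \<alpha> v + vertex_weight n \<alpha> w - (\<alpha> {v, w} :: real)"
proof -
  have "edge_cut n {v} \<inter> edge_cut n {w} = {{v, w}}"
  proof
    show "edge_cut n {v} \<inter> edge_cut n {w} \<subseteq> {{v, w}}"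
      using assms by (auto simp: cut_singleton elim!: edge_setE)
    show "{{v, w}} \<subseteq> edge_cut n {v} \<inter> edge_cut n {w}"
      using assms by (simp add: cut_singleton edge_set_iff)
  qed
  then show ?thesis
    using assms by (simp add: sum_Un vertex_weight_eq)
qed

text \<open>Counted through the complement: the edges that miss \<open>W\<close> are the pairs
  inside \<open>{1..n} - W\<close>.\<close>

lemma card_Union_cut:
  assumes "W \<subseteq> {1..n}"
  shows "card (\<Union>v\<in>W. edge_cut n {v}) = (n choose 2) - ((n - card W) choose 2)"
proof -
  have sub: "edge_cut n {v} = {e \<in> edge_set n. v \<in> e}" if "v \<in> W" for v
    using that assms cut_singleton by blast
  have "(\<Union>v\<in>W. edge_cut n {v}) = edge_set n - {e. e \<subseteq> {1..n} - W \<and> card e = 2}"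
    using sub by (auto simp: edge_set_def)
  also have "card \<dots> = card (edge_set n) - card {e. e \<subseteq> {1..n} - W \<and> card e = 2}"
    by (rule card_Diff_subset) (auto simp: edge_set_def)
  also have "\<dots> = (n choose 2) - ((n - card W) choose 2)"
    using assms finite_subset[OF assms] by (simp add: card_edge_set n_subsets card_Diff_subset)
  finally show ?thesis .
qed

text \<open>The degree sum exceeds the boundary by the edges inside \<open>S\<close>, and each
  vertex of \<open>S\<close> has at most \<open>card S\<close> of these, each of weight at most
  \<open>M\<close>. For small \<open>S\<close> the loss is minor.\<close>

lemma sum_cut_ge:
  assumes S: "S \<subseteq> {1..n}" and M: "M_bounded M n \<alpha>" "0 \<le> M"
  shows "(\<Sum>v\<in>S. vertex_weight n \<alpha> v) - (real (card S))\<^sup>2 * M \<le> sum \<alpha> (edge_cut n S)"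
proof -
  have fin: "finite S" using S finite_subset by blast
  have "vertex_weight n \<alpha> v - card S * M \<le> (\<Sum>w\<in>{1..n} - S. \<alpha> {v, w})" if v: "v \<in> S" for v
  proof -
    have "vertex_weight n \<alpha> v = (\<Sum>w\<in>({1..n} - S) \<union> (S - {v}). \<alpha> {v, w})"
      unfolding vertex_weight_def using v S by (intro sum.cong) auto
    also have "\<dots> = (\<Sum>w\<in>{1..n} - S. \<alpha> {v, w}) + (\<Sum>w\<in>S - {v}. \<alpha> {v, w})"
      using fin by (intro sum.union_disjoint) auto
    also have "(\<Sum>w\<in>S - {v}. \<alpha> {v, w}) \<le> (\<Sum>w\<in>S - {v}. M)"
    proof (rule sum_mono)
      fix w assume "w \<in> S - {v}"
      then have "{v, w} \<in> edge_set n" using S v by (auto simp: edge_set_iff)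
      then show "\<alpha> {v, w} \<le> M" using M by (simp add: M_bounded_def)
    qed
    also have "\<dots> \<le> card S * M"
      using M fin by (simp add: mult_right_mono card_mono)
    finally show ?thesis by simp
  qed
  then have "(\<Sum>v\<in>S. vertex_weight n \<alpha> v - card S * M) \<le> sum \<alpha> (edge_cut n S)"
    unfolding sum_cut[OF S] by (intro sum_mono)
  then show ?thesis by (simp add: sum_subtractf power2_eq_square)
qed

lemma reachable_in_cut_free:
  assumes "F \<subseteq> edge_set n" "edge_cut n S \<inter> F = {}" "u \<in> S" "(u, v) \<in> {(a, b). {a, b} \<in> F}\<^sup>*"
  shows "v \<in> S"
  using assms(4)
proof induction
  case base
  show ?case by fact
next
  case (step a b)
  then have "{a, b} \<in> F" "{a, b} \<in> edge_set n" using assms(1) by auto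
  then show ?case using step.IH assms(2) by (auto simp: edge_cut_def)
qed

text \<open>The vertices reachable from \<open>u\<close> form a set \<open>T\<close> with empty
  boundary. Its complement has the same boundary, so the smaller of the two can be chosen.\<close>

lemma not_connected_iff:
  assumes F: "F \<subseteq> edge_set n"
  shows "\<not> graph_connected {1..n} F \<longleftrightarrow>
    (\<exists>S\<subseteq>{1..n}. S \<noteq> {} \<and> 2 * card S \<le> n \<and> edge_cut n S \<inter> F = {})"
proof
  let ?R = "{(a, b). {a, b} \<in> F}"
  assume "\<not> graph_connected {1..n} F"
  then obtain u v where uv: "u \<in> {1..n}" "v \<in> {1..n}" "(u, v) \<notin> ?R\<^sup>*"
    by (auto simp: graph_connected_def)
  define T where "T = {w \<in> {1..n}. (u, w) \<in> ?R\<^sup>*}"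
  have T: "T \<subseteq> {1..n}" by (auto simp: T_def)
  have cT: "edge_cut n T \<inter> F = {}"
  proof (rule ccontr)
    assume "edge_cut n T \<inter> F \<noteq> {}"
    then obtain a b where ab: "a \<in> T" "b \<in> {1..n} - T" "{a, b} \<in> F"
      unfolding cut_eq_image[OF T] by (fastforce simp del: atLeastAtMost_iff)
    then have "(u, b) \<in> ?R\<^sup>*" by (auto simp: T_def intro: rtrancl_into_rtrancl)
    then show False using ab by (auto simp: T_def)
  qed
  have cT': "edge_cut n ({1..n} - T) = edge_cut n T"
    unfolding edge_cut_def edge_set_def by blast
  have ne: "u \<in> T" "v \<in> {1..n} - T" using uv by (auto simp: T_def)
  have "card ({1..n} - T) = n - card T" "card T \<le> n"
    using T finite_subset[OF T] card_mono[OF _ T] by (simp_all add: card_Diff_subset)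
  then consider "2 * card T \<le> n" | "2 * card ({1..n} - T) \<le> n" by linarith
  then show "\<exists>S\<subseteq>{1..n}. S \<noteq> {} \<and> 2 * card S \<le> n \<and> edge_cut n S \<inter> F = {}"
  proof cases
    case 1
    then show ?thesis using T cT ne by (intro exI[of _ T]) auto
  next
    case 2
    then show ?thesis using cT cT' ne by (intro exI[of _ "{1..n} - T"]) auto
  qed
next
  assume "\<exists>S\<subseteq>{1..n}. S \<noteq> {} \<and> 2 * card S \<le> n \<and> edge_cut n S \<inter> F = {}"
  then obtain S where S: "S \<subseteq> {1..n}" "S \<noteq> {}" "2 * card S \<le> n" "edge_cut n S \<inter> F = {}" by blast
  from S(2) obtain u where u: "u \<in> S" by blast
  \<comment> \<open>A nonempty set with \<open>2 * card S \<le> n\<close> cannot be all of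
    \<open>{1..n}\<close>, so some vertex lies outside and is unreachable from
    \<open>u\<close>.\<close>
  have "card S > 0" using S finite_subset[OF S(1)] by (simp add: card_gt_0_iff)
  then have "S \<noteq> {1..n}" using S(3) by auto
  then obtain v where v: "v \<in> {1..n} - S" using S(1) by blast
  have "(u, v) \<notin> {(a, b). {a, b} \<in> F}\<^sup>*"
    using reachable_in_cut_free[OF F S(4) u, of v] v by blast
  then show "\<not> graph_connected {1..n} F"
    using u v S(1) unfolding graph_connected_def by blast
qed

section \<open>Connectivity and isolated vertices\<close>

lemma empty_prob_nonneg [simp]: "0 \<le> empty_prob N t"
  by (simp add: empty_prob_def)

lemma empty_prob_le_exp:
  assumes "0 < N"
  shows "empty_prob N t \<le> exp (- t)"
proof -
  have "max 0 (1 - t / real N) \<le> exp (- t / real N)"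
    using exp_ge_add_one_self[of "- t / real N"] by auto
  then have "empty_prob N t \<le> exp (- t / real N) ^ N"
    unfolding empty_prob_def by (intro power_mono) auto
  also have "\<dots> = exp (- t)"
    using assms by (simp flip: exp_of_nat_mult)
  finally show ?thesis .
qed

definition small_sets :: "nat \<Rightarrow> nat set set" where
  "small_sets n = {S. S \<subseteq> {1..n} \<and> S \<noteq> {} \<and> 2 * card S \<le> n}"

lemma finite_small_sets [simp]: "finite (small_sets n)"
  by (rule finite_subset[of _ "Pow {1..n}"]) (auto simp: small_sets_def)

lemma not_connected_small_sets:
  assumes "F \<subseteq> edge_set n"
  shows "\<not> graph_connected {1..n} F \<longleftrightarrow> (\<exists>S\<in>small_sets n. edge_cut n S \<inter> F = {})"
  unfolding not_connected_iff[OF assms] small_sets_def Bex_def mem_Collect_eq by (simp only: conj_assoc)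

definition no_isolated :: "nat \<Rightarrow> nat set set \<Rightarrow> bool" where
  "no_isolated n F \<longleftrightarrow> (\<forall>v\<in>{1..n}. edge_cut n {v} \<inter> F \<noteq> {})"

lemma graph_connected_mono:
  assumes "graph_connected V F" "F \<subseteq> F'"
  shows "graph_connected V F'"
proof -
  have "{(a, b). {a, b} \<in> F}\<^sup>* \<subseteq> {(a, b). {a, b} \<in> F'}\<^sup>*"
    using assms(2) by (intro rtrancl_mono) auto
  then show ?thesis using assms(1) unfolding graph_connected_def by blast
qed

context simplex_graph
begin

definition avoid :: "real \<Rightarrow> nat set set \<Rightarrow> (nat set \<Rightarrow> real) set" where
  "avoid p S = {X \<in> space U. S \<inter> threshold_edges n p X = {}}"

lemma avoid_sets [measurable]: "avoid p S \<in> sets U"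
  unfolding avoid_def by (rule sets_threshold)

lemma prob_avoid: "S \<subseteq> edge_set n \<Longrightarrow> 0 \<le> p \<Longrightarrow> prob (avoid p S) = empty_prob N (sum \<alpha> S * p)"
  unfolding avoid_def by (rule prob_no_edges)

lemma integrable_avoid: "integrable U (indicator (avoid p S) :: _ \<Rightarrow> real)"
  by (simp add: integrable_indicator_iff less_top[symmetric])

lemma avoid_Un: "avoid p (S \<union> T) = avoid p S \<inter> avoid p T"
  by (auto simp: avoid_def)

lemma threshold_subset: "threshold_edges n p X \<subseteq> edge_set n"
  by (auto simp: threshold_edges_def)

lemma prob_connected_mono:
  assumes "p \<le> p'"
  shows "prob_connected n \<alpha> p \<le> prob_connected n \<alpha> p'"
  unfolding prob_connected_def
proof (rule finite_measure_mono)
  have "threshold_edges n p X \<subseteq> threshold_edges n p' X" for X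
    using assms by (auto simp: threshold_edges_def)
  then show "{X \<in> space U. graph_connected {1..n} (threshold_edges n p X)} \<subseteq>
      {X \<in> space U. graph_connected {1..n} (threshold_edges n p' X)}"
    using graph_connected_mono by blast
qed (rule sets_threshold)

lemma prob_connected_bounds: "0 \<le> prob_connected n \<alpha> p" "prob_connected n \<alpha> p \<le> 1"
  by (simp_all add: prob_connected_def)

lemma prob_not_connected_le:
  assumes "0 \<le> p"
  shows "1 - prob_connected n \<alpha> p \<le> (\<Sum>S\<in>small_sets n. empty_prob N (sum \<alpha> (edge_cut n S) * p))"
proof -
  have "1 - prob_connected n \<alpha> p = \<P>(X in U. \<not> graph_connected {1..n} (threshold_edges n p X))"
    unfolding prob_connected_def by (rule prob_neg[symmetric]) (rule sets_threshold)
  also have "\<dots> \<le> prob (\<Union>S\<in>small_sets n. avoid p (edge_cut n S))"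
  proof (rule finite_measure_mono)
    show "{X \<in> space U. \<not> graph_connected {1..n} (threshold_edges n p X)} \<subseteq>
        (\<Union>S\<in>small_sets n. avoid p (edge_cut n S))"
      using not_connected_small_sets[OF threshold_subset] by (auto simp: avoid_def)
  qed (auto intro!: sets.finite_UN)
  also have "\<dots> \<le> (\<Sum>S\<in>small_sets n. prob (avoid p (edge_cut n S)))"
    by (rule finite_measure_subadditive_finite) auto
  finally show ?thesis using assms by (simp add: prob_avoid cut_subset)
qed

definition prob_no_isolated :: "real \<Rightarrow> real" where
  "prob_no_isolated p = \<P>(X in U. no_isolated n (threshold_edges n p X))"

text \<open>For \<open>n \<ge> 2\<close> a singleton is among the small sets, so an isolated vertex
  already disconnects the graph.\<close>

lemma prob_connected_le_no_isolated: "prob_connected n \<alpha> p \<le> prob_no_isolated p"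
  unfolding prob_connected_def prob_no_isolated_def
proof (rule finite_measure_mono)
  have "graph_connected {1..n} F \<Longrightarrow> no_isolated n F" if "F \<subseteq> edge_set n" for F
  proof -
    have "{v} \<in> small_sets n" if "v \<in> {1..n}" for v
      using that n2 by (simp add: small_sets_def)
    then show "graph_connected {1..n} F \<Longrightarrow> no_isolated n F"
      using not_connected_small_sets[OF that] unfolding no_isolated_def by blast
  qed
  then show "{X \<in> space U. graph_connected {1..n} (threshold_edges n p X)} \<subseteq>
      {X \<in> space U. no_isolated n (threshold_edges n p X)}"
    using threshold_subset by blast
qed (rule sets_threshold)

text \<open>A component without isolated vertices contains an edge \<open>e\<close>, so the event that its boundary
  is empty has to be counted only outside the event that also \<open>e\<close> is missing.\<close>
lemma prob_no_isolated_le: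
  assumes "0 \<le> p"
  shows "prob_no_isolated p \<le> prob_connected n \<alpha> p +
    (\<Sum>S\<in>{S \<in> small_sets n. 2 \<le> card S}. \<Sum>e\<in>{e \<in> edge_set n. e \<subseteq> S}.
      empty_prob N (sum \<alpha> (edge_cut n S) * p) - empty_prob N ((sum \<alpha> (edge_cut n S) + \<alpha> e) * p))"
proof -
  let ?C = "{X \<in> space U. graph_connected {1..n} (threshold_edges n p X)}"
  let ?SS = "{S \<in> small_sets n. 2 \<le> card S}"
  let ?D = "\<lambda>S e. avoid p (edge_cut n S) - avoid p (insert e (edge_cut n S))"
  let ?B = "\<Union>S\<in>?SS. \<Union>e\<in>{e \<in> edge_set n. e \<subseteq> S}. ?D S e"
  have C: "?C \<in> sets U" by (rule sets_threshold)
  have DS: "(\<Union>e\<in>{e \<in> edge_set n. e \<subseteq> S}. ?D S e) \<in> sets U" for S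
    by (intro sets.finite_UN sets.Diff avoid_sets) auto
  have B: "?B \<in> sets U"
    by (intro sets.finite_UN DS) auto
  have "prob_no_isolated p \<le> prob (?C \<union> ?B)"
    unfolding prob_no_isolated_def
  proof (rule finite_measure_mono)
    show "{X \<in> space U. no_isolated n (threshold_edges n p X)} \<subseteq> ?C \<union> ?B"
    proof
      fix X assume X: "X \<in> {X \<in> space U. no_isolated n (threshold_edges n p X)}"
      let ?F = "threshold_edges n p X"
      show "X \<in> ?C \<union> ?B"
      proof (cases "graph_connected {1..n} ?F")
        case False
        then obtain S where "S \<in> small_sets n" and cS: "edge_cut n S \<inter> ?F = {}"
          unfolding not_connected_small_sets[OF threshold_subset] by (elim bexE)
        then have S: "S \<subseteq> {1..n}" "S \<noteq> {}" "2 * card S \<le> n"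
          by (simp_all add: small_sets_def)
        then obtain v where v: "v \<in> S" "v \<in> {1..n}" by blast
        \<comment> \<open>The vertex \<open>v\<close> of \<open>S\<close> has some edge, and the
          empty boundary of \<open>S\<close> forces this edge to lie inside \<open>S\<close>. In
          particular \<open>S\<close> has at least two vertices.\<close>
        then obtain e where e: "e \<in> edge_cut n {v}" "e \<in> ?F"
          using X unfolding no_isolated_def by blast
        then have eE: "e \<in> edge_set n" "v \<in> e" using v by (auto simp: cut_singleton)
        then have eS: "e \<subseteq> S" using cS e(2) v by (auto simp: edge_cut_def)
        have "card e \<le> card S" using eS S(1) by (intro card_mono) (auto dest: finite_subset)
        then have "S \<in> ?SS" using eE S by (auto simp: small_sets_def edge_set_def)
        moreover have "X \<in> ?D S e" using X cS e(2) by (auto simp: avoid_def)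
        ultimately show ?thesis using eE eS by blast
      qed (use X in auto)
    qed
  qed (use B C in auto)
  also have "\<dots> \<le> prob ?C + prob ?B"
    by (rule measure_Un_le[OF C B])
  also have "prob ?B \<le> (\<Sum>S\<in>?SS. prob (\<Union>e\<in>{e \<in> edge_set n. e \<subseteq> S}. ?D S e))"
    by (rule finite_measure_subadditive_finite) (use DS in auto)
  also have "\<dots> \<le> (\<Sum>S\<in>?SS. \<Sum>e\<in>{e \<in> edge_set n. e \<subseteq> S}. prob (?D S e))"
    by (intro sum_mono finite_measure_subadditive_finite) auto
  also have "\<dots> = (\<Sum>S\<in>?SS. \<Sum>e\<in>{e \<in> edge_set n. e \<subseteq> S}.
      empty_prob N (sum \<alpha> (edge_cut n S) * p) - empty_prob N ((sum \<alpha> (edge_cut n S) + \<alpha> e) * p))"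
  proof (intro sum.cong refl)
    fix S e assume e: "e \<in> {e \<in> edge_set n. e \<subseteq> S}"
    have "prob (?D S e) = prob (avoid p (edge_cut n S)) - prob (avoid p (insert e (edge_cut n S)))"
      by (rule finite_measure_Diff) (auto simp: avoid_def intro!: sets_threshold)
    moreover have "e \<notin> edge_cut n S" using e by (auto simp: edge_cut_def)
    ultimately show "prob (?D S e) =
        empty_prob N (sum \<alpha> (edge_cut n S) * p) - empty_prob N ((sum \<alpha> (edge_cut n S) + \<alpha> e) * p)"
      using e assms cut_subset by (simp add: prob_avoid add.commute)
  qed
  finally show ?thesis by (simp add: prob_connected_def)
qed

text \<open>Inclusion-exclusion: expand the product over all \<open>v\<close> of one minus the
  indicator that \<open>v\<close> is isolated. The product of indicators over \<open>W\<close> is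
  the indicator that the union of the stars of \<open>W\<close> is missing, whose probability is
  known exactly.\<close>

lemma prob_no_isolated_eq:
  assumes "0 \<le> p"
  shows "prob_no_isolated p =
    (\<Sum>W\<in>Pow {1..n}. (- 1) ^ card W * empty_prob N (sum \<alpha> (\<Union>v\<in>W. edge_cut n {v}) * p))"
proof -
  let ?E = "\<lambda>W. avoid p (\<Union>v\<in>W. edge_cut n {v})"
  have ind: "indicator {X \<in> space U. no_isolated n (threshold_edges n p X)} X =
      (\<Sum>W\<in>Pow {1..n}. (- 1) ^ card W * indicator (?E W) X :: real)" if X: "X \<in> space U" for X
  proof -
    have "indicator {X \<in> space U. no_isolated n (threshold_edges n p X)} X =
        (\<Prod>v\<in>{1..n}. - indicator (?E {v}) X + 1 :: real)"
      using X by (auto simp: indicator_def no_isolated_def avoid_def prod_zero_iff)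
    also have "\<dots> = (\<Sum>W\<in>Pow {1..n}. \<Prod>v\<in>W. - indicator (?E {v}) X)"
      by (subst prod_add) auto
    also have "\<dots> = (\<Sum>W\<in>Pow {1..n}. (- 1) ^ card W * indicator (?E W) X)"
    proof (rule sum.cong)
      fix W assume "W \<in> Pow {1..n}"
      then have "finite W" using finite_subset by auto
      have "(\<Prod>v\<in>W. indicator (?E {v}) X :: real) = indicator (?E W) X"
      proof (cases "X \<in> ?E W")
        case True
        then have "indicator (?E {v}) X = (1 :: real)" if "v \<in> W" for v
          using that by (auto simp: avoid_def indicator_def)
        then show ?thesis using True by simp
      next
        case False
        then obtain v where "v \<in> W" "X \<notin> ?E {v}" using X by (auto simp: avoid_def)
        then have "\<exists>v\<in>W. indicator (?E {v}) X = (0 :: real)" by (intro bexI[of _ v]) auto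
        with False show ?thesis using prod_zero[OF \<open>finite W\<close>] by simp
      qed
      then show "(\<Prod>v\<in>W. - indicator (?E {v}) X :: real) = (- 1) ^ card W * indicator (?E W) X"
        by (simp add: prod_uminus)
    qed simp
    finally show ?thesis .
  qed
  have sub: "(\<Union>v\<in>W. edge_cut n {v}) \<subseteq> edge_set n" for W using cut_subset by blast
  have "prob_no_isolated p =
      (\<integral>X. indicator {X \<in> space U. no_isolated n (threshold_edges n p X)} X \<partial>U)"
    unfolding prob_no_isolated_def using sets_threshold by simp
  also have "\<dots> = (\<integral>X. (\<Sum>W\<in>Pow {1..n}. (- 1) ^ card W * indicator (?E W) X) \<partial>U)"
    using ind by (intro Bochner_Integration.integral_cong) auto
  also have "\<dots> = (\<Sum>W\<in>Pow {1..n}. (- 1) ^ card W * prob (?E W))"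
    by (subst Bochner_Integration.integral_sum) (auto intro!: integrable_avoid)
  finally show ?thesis using assms by (simp add: prob_avoid sub)
qed

text \<open>\<open>Z\<close> counts the isolated vertices. If there are none, \<open>Z\<close>
  deviates from its mean by \<open>\<mu>\<close>, and Chebyshev bounds this by the variance over the
  square of \<open>\<mu>\<close>; the double sum is the second moment, including the
  diagonal.\<close>

lemma prob_no_isolated_second_moment:
  assumes "0 \<le> p"
  defines "\<mu> \<equiv> (\<Sum>v\<in>{1..n}. empty_prob N (vertex_weight n \<alpha> v * p))"
  assumes \<mu>: "0 < \<mu>"
  shows "prob_no_isolated p \<le>
    (\<Sum>v\<in>{1..n}. \<Sum>w\<in>{1..n}. empty_prob N (sum \<alpha> (edge_cut n {v} \<union> edge_cut n {w}) * p)) / \<mu>\<^sup>2 - 1"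
proof -
  let ?I = "\<lambda>v. indicator (avoid p (edge_cut n {v})) :: _ \<Rightarrow> real"
  define Z where "Z X = (\<Sum>v\<in>{1..n}. ?I v X)" for X
  have [measurable]: "Z \<in> borel_measurable U" unfolding Z_def by measurable
  have EZ: "expectation Z = \<mu>"
    unfolding Z_def \<mu>_def using assms(1)
    by (simp add: Bochner_Integration.integral_sum integrable_avoid prob_avoid cut_subset vertex_weight_eq)
  have Z2: "Z X ^ 2 = (\<Sum>v\<in>{1..n}. \<Sum>w\<in>{1..n}. indicator (avoid p (edge_cut n {v} \<union> edge_cut n {w})) X)" for X
    by (simp add: Z_def power2_eq_square sum_product avoid_Un indicator_inter_arith)
  have intZ: "integrable U Z" unfolding Z_def using integrable_avoid by auto
  have intZ2: "integrable U (\<lambda>X. (Z X)\<^sup>2)"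
    unfolding Z2 by (intro Bochner_Integration.integrable_sum integrable_avoid)
  have EZ2: "expectation (\<lambda>X. (Z X)\<^sup>2) =
      (\<Sum>v\<in>{1..n}. \<Sum>w\<in>{1..n}. empty_prob N (sum \<alpha> (edge_cut n {v} \<union> edge_cut n {w}) * p))"
    unfolding Z2 using assms(1)
    by (simp add: Bochner_Integration.integral_sum Bochner_Integration.integrable_sum integrable_avoid prob_avoid cut_subset)
  have "prob_no_isolated p \<le> \<P>(X in U. \<mu> \<le> \<bar>Z X - expectation Z\<bar>)"
    unfolding prob_no_isolated_def
  proof (rule finite_measure_mono)
    show "{X \<in> space U. no_isolated n (threshold_edges n p X)} \<subseteq>
        {X \<in> space U. \<mu> \<le> \<bar>Z X - expectation Z\<bar>}"
    proof clarify
      fix X assume "no_isolated n (threshold_edges n p X)"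
      then have "Z X = 0"
        by (auto simp: Z_def no_isolated_def avoid_def)
      then show "\<mu> \<le> \<bar>Z X - expectation Z\<bar>" using \<mu> by (simp add: EZ)
    qed
  qed measurable
  also have "\<dots> \<le> variance Z / \<mu>\<^sup>2"
    using \<mu> intZ2 by (intro Chebyshev_inequality) auto
  also have "variance Z = expectation (\<lambda>X. (Z X)\<^sup>2) - \<mu>\<^sup>2"
    using intZ intZ2 by (subst variance_eq) (auto simp: EZ)
  also have "\<dots> / \<mu>\<^sup>2 = expectation (\<lambda>X. (Z X)\<^sup>2) / \<mu>\<^sup>2 - 1"
    using \<mu> by (simp add: field_simps)
  finally show ?thesis by (simp add: EZ2)
qed

end

section \<open>Elementary estimates\<close>

text \<open>The \<open>N\<close>-th power of \<open>1 - x \<ge> exp (- x - 2 * x ^ 2)\<close>, valid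
  for \<open>x = t / N \<le> 1 / 2\<close>. Together with \<open>empty_prob_le_exp\<close> it pins
  the value down to a factor tending to 1 when \<open>t ^ 2\<close> is small against
  \<open>N\<close>.\<close>

lemma empty_prob_ge_exp:
  assumes "0 \<le> t" "2 * t \<le> real N"
  shows "exp (- t - 2 * t\<^sup>2 / real N) \<le> empty_prob N t"
proof (cases "N = 0")
  case False
  define x where "x = t / real N"
  have x: "0 \<le> x" "x \<le> 1 / 2" using assms False by (auto simp: x_def field_simps)
  have "- x - 2 * x\<^sup>2 \<le> ln (1 - x)"
    using x by (intro ln_one_minus_pos_lower_bound) auto
  then have "exp (- x - 2 * x\<^sup>2) \<le> 1 - x"
    using x by (subst (asm) ln_ge_iff) auto
  then have "exp (- x - 2 * x\<^sup>2) ^ N \<le> (1 - x) ^ N"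
    by (intro power_mono) auto
  also have "exp (- x - 2 * x\<^sup>2) ^ N = exp (real N * (- x - 2 * x\<^sup>2))"
    by (rule exp_of_nat_mult[symmetric])
  also have "real N * (- x - 2 * x\<^sup>2) = - t - 2 * t\<^sup>2 / real N"
    using False by (simp add: x_def field_simps power2_eq_square)
  also have "(1 - x) ^ N = empty_prob N t"
    using x by (simp add: empty_prob_def x_def)
  finally show ?thesis .
qed (use assms in \<open>simp add: empty_prob_def\<close>)

text \<open>This is the gain from an edge that must be present. With base
  \<open>x \<ge> 1 / 2\<close> and \<open>d = p / N\<close> one has
  \<open>x - d \<ge> x * (1 - 2 * d)\<close>, and Bernoulli gives
  \<open>(1 - 2 * d) ^ N \<ge> 1 - 2 * p\<close>.\<close>

lemma empty_prob_diff_le: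
  assumes "0 \<le> p" "2 * p \<le> real N" "2 * t \<le> real N" "0 < N"
  shows "empty_prob N t - empty_prob N (t + p) \<le> 2 * p * empty_prob N t"
proof -
  define x where "x = 1 - t / real N"
  have x: "1 / 2 \<le> x" using assms by (simp add: x_def field_simps)
  define d where "d = p / real N"
  have d: "0 \<le> d" "2 * d \<le> 1" using assms by (simp_all add: d_def field_simps)
  have "1 - 2 * p = 1 + real N * (- 2 * d)" using assms by (simp add: d_def)
  also have "\<dots> \<le> (1 + (- 2 * d)) ^ N"
    using d by (intro Bernoulli_inequality) auto
  finally have "x ^ N * (1 - 2 * p) \<le> x ^ N * (1 - 2 * d) ^ N"
    using x by (intro mult_left_mono) auto
  also have "\<dots> = (x * (1 - 2 * d)) ^ N" by (simp add: power_mult_distrib)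
  also have "\<dots> \<le> (max 0 (x - d)) ^ N"
  proof (intro power_mono)
    have "1 * d \<le> 2 * x * d" using x d by (intro mult_right_mono) auto
    then show "x * (1 - 2 * d) \<le> max 0 (x - d)" by (simp add: algebra_simps)
  qed (use x d in auto)
  also have "\<dots> = empty_prob N (t + p)"
    by (simp add: empty_prob_def x_def d_def add_divide_distrib algebra_simps)
  finally have "x ^ N * (1 - 2 * p) \<le> empty_prob N (t + p)" .
  moreover have "empty_prob N t = x ^ N" using x by (simp add: empty_prob_def x_def)
  ultimately show ?thesis by (simp add: algebra_simps)
qed

text \<open>Near independence of two isolation events, with \<open>d\<close> the contribution of the
  shared edge. Without it, \<open>1 - (x + y) \<le> (1 - x) * (1 - y)\<close> is negative
  correlation; since that product is at least 1/2, adding \<open>z = d / N\<close> costs at most the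
  factor \<open>1 + 2 * z \<le> exp (2 * z)\<close>, hence \<open>exp (2 * d)\<close> after the
  power.\<close>

lemma empty_prob_sub_le:
  assumes "0 \<le> t" "4 * t \<le> real N" "0 \<le> s" "4 * s \<le> real N" "0 \<le> d" "0 < N"
  shows "empty_prob N (t + s - d) \<le> exp (2 * d) * (empty_prob N t * empty_prob N s)"
proof -
  define x y z where "x = t / real N" and "y = s / real N" and "z = d / real N"
  have xyz: "0 \<le> x" "x \<le> 1 / 4" "0 \<le> y" "y \<le> 1 / 4" "0 \<le> z"
    using assms by (auto simp: x_def y_def z_def field_simps)
  have half: "1 / 2 \<le> (1 - x) * (1 - y)"
    using xyz mult_mono[of "3/4" "1 - x" "3/4" "1 - y"] by simp
  have "1 - (x + y - z) \<le> (1 - x) * (1 - y) + z"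
    using xyz by (simp add: algebra_simps)
  also have "\<dots> \<le> (1 - x) * (1 - y) * (1 + 2 * z)"
    using mult_right_mono[OF half, of "2 * z"] xyz by (simp add: algebra_simps)
  also have "\<dots> \<le> (1 - x) * (1 - y) * exp (2 * z)"
    using half exp_ge_add_one_self[of "2 * z"] by (intro mult_left_mono) auto
  finally have "max 0 (1 - (x + y - z)) \<le> (1 - x) * (1 - y) * exp (2 * z)"
    using xyz by (simp add: mult_nonneg_nonneg)
  then have "max 0 (1 - (x + y - z)) ^ N \<le> ((1 - x) * (1 - y) * exp (2 * z)) ^ N"
    by (intro power_mono) auto
  also have "\<dots> = (1 - x) ^ N * (1 - y) ^ N * exp (real N * (2 * z))"
    by (simp add: power_mult_distrib flip: exp_of_nat_mult)
  also have "real N * (2 * z) = 2 * d" using assms by (simp add: z_def)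
  finally show ?thesis
    using xyz by (simp add: empty_prob_def x_def y_def z_def add_divide_distrib diff_divide_distrib mult_ac)
qed

text \<open>A single term of the expansion of \<open>(1 + x) ^ n \<le> exp (n * x)\<close>, taken at
  \<open>x = k / n\<close>.\<close>

lemma binomial_le_exp_power:
  assumes "0 < k"
  shows "real (n choose k) \<le> (exp 1 * real n / real k) ^ k"
proof (cases "n = 0")
  case False
  define x where "x = real k / real n"
  have x: "0 < x" using assms False by (simp add: x_def)
  have "real (n choose k) * x ^ k \<le> (\<Sum>i\<le>n. real (n choose i) * x ^ i)"
  proof (cases "k \<le> n")
    case True
    have "real (n choose k) * x ^ k = (\<Sum>i\<in>{k}. real (n choose i) * x ^ i)" by simp
    also have "\<dots> \<le> (\<Sum>i\<le>n. real (n choose i) * x ^ i)"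
      using True x by (intro sum_mono2) auto
    finally show ?thesis .
  qed (use x in \<open>simp add: binomial_eq_0 sum_nonneg\<close>)
  also have "\<dots> = (x + 1) ^ n"
    by (simp add: binomial_ring)
  also have "\<dots> \<le> exp x ^ n"
    using x exp_ge_add_one_self[of x] by (intro power_mono) (auto simp: add.commute)
  also have "\<dots> = exp 1 ^ k"
    using False by (simp add: x_def flip: exp_of_nat_mult)
  finally have "real (n choose k) \<le> exp 1 ^ k / x ^ k"
    using x by (simp add: pos_le_divide_eq)
  also have "\<dots> = (exp 1 * real n / real k) ^ k"
    by (simp add: x_def power_divide[symmetric])
  finally show ?thesis .
qed (use assms in \<open>simp add: binomial_eq_0\<close>)

lemma sum_subsets_by_card:
  fixes g :: "nat \<Rightarrow> real"
  assumes "finite A"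
  shows "(\<Sum>S | S \<subseteq> A \<and> P (card S). g (card S)) = (\<Sum>k | k \<le> card A \<and> P k. real (card A choose k) * g k)"
proof -
  have "(\<Sum>S | S \<subseteq> A \<and> P (card S). g (card S)) =
      (\<Sum>k | k \<le> card A \<and> P k. \<Sum>S\<in>{S \<in> {S. S \<subseteq> A \<and> P (card S)}. card S = k}. g (card S))"
    using assms by (intro sum.group[symmetric]) (auto intro: card_mono)
  also have "\<dots> = (\<Sum>k | k \<le> card A \<and> P k. real (card A choose k) * g k)"
  proof (rule sum.cong)
    fix k assume "k \<in> {k. k \<le> card A \<and> P k}"
    then have "{S \<in> {S. S \<subseteq> A \<and> P (card S)}. card S = k} = {S. S \<subseteq> A \<and> card S = k}" by auto
    then show "(\<Sum>S\<in>{S \<in> {S. S \<subseteq> A \<and> P (card S)}. card S = k}. g (card S)) = real (card A choose k) * g k"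
      using assms by (simp add: n_subsets)
  qed simp
  finally show ?thesis .
qed

text \<open>The sum over all subsets factorises into the product of \<open>1 + y v\<close>; the
  empty set accounts for the \<open>- 1\<close>. This evaluates the union bound over small sets at
  once.\<close>

lemma sum_nonempty_subsets_prod_le:
  fixes y :: "'a \<Rightarrow> real"
  assumes "finite A" "\<And>v. v \<in> A \<Longrightarrow> 0 \<le> y v"
  shows "(\<Sum>S\<in>Pow A - {{}}. \<Prod>v\<in>S. y v) \<le> exp (\<Sum>v\<in>A. y v) - 1"
proof -
  have "(\<Sum>S\<in>Pow A - {{}}. \<Prod>v\<in>S. y v) = (\<Sum>S\<in>Pow A. \<Prod>v\<in>S. y v) - 1"
    using assms(1) by (subst sum_diff1) auto
  also have "(\<Sum>S\<in>Pow A. \<Prod>v\<in>S. y v) = (\<Prod>v\<in>A. y v + 1)"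
    using assms(1) by (simp add: prod_add)
  also have "\<dots> \<le> (\<Prod>v\<in>A. exp (y v))"
    using assms(2) exp_ge_add_one_self by (intro prod_mono) (auto simp: add.commute)
  also have "\<dots> = exp (\<Sum>v\<in>A. y v)" using assms(1) by (simp add: exp_sum)
  finally show ?thesis by simp
qed

lemma real_choose_2: "real (n choose 2) = real n * (real n - 1) / 2"
  by (cases n) (simp_all add: choose_two real_of_nat_div algebra_simps)

section \<open>Bounded weights\<close>

text \<open>A lower bound for all expected degrees \<open>\<alpha>\<^sub>v p\<^sub>0\<close>, see \<open>degree_p0_lower\<close> below.\<close>
definition lam :: "nat \<Rightarrow> real" where
  "lam n = ln (real n / 2) / sqrt (ln (real n))"

text \<open>The \<open>large_\<close> assumptions hold for all sufficiently large \<open>n\<close>. Since \<open>M\<^sup>2 \<le> (ln n)\<^bsup>1/2\<^esup>\<close>,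
  they say in turn: \<open>p\<^sub>0\<close> exists; \<open>\<alpha>\<^sub>v p\<^sub>0 \<le> N / 4\<close>; \<open>\<xi>\<^sub>v(p\<^sub>0)\<close> is at least
  \<open>exp (- \<alpha>\<^sub>v p\<^sub>0) / 2\<close>; and edges inside a set of at most \<open>n exp (- (ln n)\<^bsup>1/2\<^esup> / 8)\<close> vertices
  are negligible for the size of its boundary.\<close>
locale bounded_graph = simplex_graph +
  fixes M :: real
  assumes bounded: "M_bounded M n \<alpha>" and M_le: "M \<le> ln (real n) powr (1 / 4)"
    and large_exists: "real n * exp (- real N / sqrt (ln (real n))) \<le> 1"
    and large_degree: "4 * (ln (real n) * sqrt (ln (real n))) \<le> real N"
    and large_exp: "1 / 2 \<le> exp (- 2 * (ln (real n) * sqrt (ln (real n)))\<^sup>2 / real N)"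
    and large_split: "exp (- sqrt (ln (real n)) / 8) *
      (2 * (ln (real n) * sqrt (ln (real n)))) * (real n / (real n - 1)) \<le> 1"
begin

abbreviation "ell \<equiv> ln (real n)"
abbreviation "w \<equiv> vertex_weight n \<alpha>"

lemma ell_pos: "0 < ell"
  using n2 by simp

lemma M_ge_1: "1 \<le> M"
proof -
  have e: "{1, 2} \<in> edge_set n" using n2 by (simp add: edge_set_iff)
  have b: "1 / M \<le> \<alpha> {1, 2}" "\<alpha> {1, 2} \<le> M" using bounded e by (auto simp: M_bounded_def)
  then have "0 < M" using pos[OF e] by simp
  with b have "1 \<le> M * \<alpha> {1, 2}" by (simp add: field_simps)
  also have "\<dots> \<le> M * M" using b \<open>0 < M\<close> by (intro mult_left_mono) auto
  finally have "1 \<le> M * M" .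
  then show ?thesis using \<open>0 < M\<close> using mult_strict_mono[of M 1 M 1] by force
qed

lemma M_sq_le: "M\<^sup>2 \<le> sqrt ell"
proof -
  have "M\<^sup>2 \<le> (ell powr (1 / 4))\<^sup>2" using M_le M_ge_1 by (intro power_mono) auto
  also have "\<dots> = sqrt ell"
    using ell_pos by (simp add: powr_half_sqrt[symmetric] power2_eq_square flip: powr_add)
  finally show ?thesis .
qed

lemma edge_weight_bounds:
  assumes "v \<in> {1..n}" "u \<in> {1..n}" "u \<noteq> v"
  shows "1 / M \<le> \<alpha> {v, u}" "\<alpha> {v, u} \<le> M"
  using bounded assms by (auto simp: M_bounded_def edge_set_iff)

lemma weight_bounds:
  assumes "v \<in> {1..n}"
  shows "(real n - 1) / M \<le> w v" "w v \<le> (real n - 1) * M"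
proof -
  have c: "real (card ({1..n} - {v})) = real n - 1" using assms n2 by simp
  have "(\<Sum>u\<in>{1..n} - {v}. 1 / M) \<le> w v"
    unfolding vertex_weight_def using assms by (intro sum_mono edge_weight_bounds) auto
  then show "(real n - 1) / M \<le> w v" using c by simp
  have "w v \<le> (\<Sum>u\<in>{1..n} - {v}. M)"
    unfolding vertex_weight_def using assms by (intro sum_mono edge_weight_bounds) auto
  then show "w v \<le> (real n - 1) * M" using c by simp
qed

lemma weight_pos: "v \<in> {1..n} \<Longrightarrow> 0 < w v"
  using M_ge_1 n2 by (intro less_le_trans[OF _ weight_bounds(1)] divide_pos_pos) auto

definition admissible :: "real \<Rightarrow> bool" where
  "admissible p \<longleftrightarrow> (\<forall>v\<in>{1..n}. 0 \<le> w v * p \<and> w v * p \<le> real N)"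

lemma xi_eq: "admissible p \<Longrightarrow> v \<in> {1..n} \<Longrightarrow> xi n \<alpha> v p = empty_prob N (w v * p)"
  unfolding xi_def empty_prob_def using N_pos by (subst max_absorb2) (auto simp: admissible_def divide_le_eq_1)

lemma sum_xi_strict_antimono:
  assumes "admissible p" "admissible p'" "p < p'"
  shows "(\<Sum>v\<in>{1..n}. xi n \<alpha> v p') < (\<Sum>v\<in>{1..n}. xi n \<alpha> v p)"
proof (rule sum_strict_mono)
  fix v assume v: "v \<in> {1..n}"
  have "w v * p < w v * p'" using weight_pos[OF v] assms(3) by simp
  then have "1 - w v * p' / real N < 1 - w v * p / real N"
    using N_pos by (intro diff_strict_left_mono divide_strict_right_mono) auto
  moreover have "0 \<le> 1 - w v * p' / real N"
    using assms(2) v N_pos by (auto simp: admissible_def divide_le_eq_1)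
  ultimately show "xi n \<alpha> v p' < xi n \<alpha> v p"
    unfolding xi_def using N_pos by (intro power_strict_mono) auto
qed (use n2 in auto)

text \<open>Intermediate value theorem between 0, where the sum is \<open>n\<close>, and the right
  end \<open>b\<close> of the admissible range. There every \<open>w v * b\<close> is at least
  \<open>N / M ^ 2\<close>, as all weights lie between \<open>(n - 1) / M\<close> and
  \<open>(n - 1) * M\<close>, and \<open>large_exists\<close> makes the sum at most 1.\<close>

lemma solution_exists: "\<exists>p. admissible p \<and> (\<Sum>v\<in>{1..n}. xi n \<alpha> v p) = 1"
proof -
  let ?f = "\<lambda>p. \<Sum>v\<in>{1..n}. xi n \<alpha> v p"
  define a where "a = Max (w ` {1..n})"
  have ne: "{1..n} \<noteq> {}" using n2 by auto
  have "a \<in> w ` {1..n}" unfolding a_def using ne by (intro Max_in) auto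
  then obtain z where z: "z \<in> {1..n}" "a = w z" by auto
  have wa: "w v \<le> a" if "v \<in> {1..n}" for v unfolding a_def using that by (intro Max_ge) auto
  have a: "0 < a" "a \<le> (real n - 1) * M" using z weight_pos weight_bounds by auto
  \<comment> \<open>The heaviest vertex is the first to violate
    \<open>w v * p \<le> N\<close>.\<close>
  define b where "b = real N / a"
  have b: "0 \<le> b" using a by (simp add: b_def)
  have adm: "admissible p" if "0 \<le> p" "p \<le> b" for p
  proof -
    have "w v * p \<le> real N" if v: "v \<in> {1..n}" for v
    proof -
      have "w v * p \<le> a * b"
        using v wa that \<open>p \<le> b\<close> \<open>0 \<le> p\<close> a by (intro mult_mono) auto
      then show ?thesis using a by (simp add: b_def)
    qed
    then show ?thesis using that weight_pos by (auto simp: admissible_def less_imp_le)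
  qed
  have f0: "1 \<le> ?f 0" using n2 by (simp add: xi_def)
  have "xi n \<alpha> v b \<le> exp (- real N / sqrt ell)" if v: "v \<in> {1..n}" for v
  proof -
    have "xi n \<alpha> v b = empty_prob N (w v * b)" using adm b v by (simp add: xi_eq)
    also have "\<dots> \<le> exp (- (w v * b))" by (rule empty_prob_le_exp[OF N_pos])
    also have "\<dots> \<le> exp (- real N / sqrt ell)"
    proof -
      have "real N / sqrt ell \<le> real N / M\<^sup>2"
        using M_sq_le M_ge_1 ell_pos by (intro divide_left_mono mult_pos_pos) auto
      also have "\<dots> = ((real n - 1) / M) * (real N / ((real n - 1) * M))"
        using n2 by (simp add: power2_eq_square)
      also have "\<dots> \<le> w v * (real N / a)"
        using weight_bounds(1)[OF v] a M_ge_1 n2 weight_pos[OF v]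
        by (intro mult_mono divide_left_mono mult_pos_pos) auto
      finally show ?thesis by (simp add: b_def)
    qed
    finally show ?thesis .
  qed
  then have "?f b \<le> (\<Sum>v\<in>{1..n}. exp (- real N / sqrt ell))" by (rule sum_mono)
  also have "\<dots> \<le> 1" using large_exists by simp
  finally have "?f b \<le> 1" .
  moreover have "continuous_on {0..b} ?f"
    unfolding xi_def by (intro continuous_intros) (use N_pos in auto)
  ultimately obtain p where "0 \<le> p" "p \<le> b" "?f p = 1"
    using IVT2'[of ?f b 1 0] f0 b by auto
  then show ?thesis using adm by blast
qed

abbreviation "q \<equiv> p0 n \<alpha>"

lemma p0_solution: "admissible q" "(\<Sum>v\<in>{1..n}. xi n \<alpha> v q) = 1"
proof -
  have "\<exists>!p. admissible p \<and> (\<Sum>v\<in>{1..n}. xi n \<alpha> v p) = 1"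
  proof (rule ex_ex1I[OF solution_exists])
    show "p = p'" if "admissible p \<and> (\<Sum>v\<in>{1..n}. xi n \<alpha> v p) = 1"
      "admissible p' \<and> (\<Sum>v\<in>{1..n}. xi n \<alpha> v p') = 1" for p p'
      using that sum_xi_strict_antimono[of p p'] sum_xi_strict_antimono[of p' p]
      by (cases p p' rule: linorder_cases) auto
  qed
  then have "admissible q \<and> (\<Sum>v\<in>{1..n}. xi n \<alpha> v q) = 1"
    unfolding p0_def admissible_def by (rule theI')
  then show "admissible q" "(\<Sum>v\<in>{1..n}. xi n \<alpha> v q) = 1" by auto
qed

lemma sum_empty_prob_p0: "(\<Sum>v\<in>{1..n}. empty_prob N (w v * q)) = 1"
  using p0_solution by (simp add: xi_eq)

lemma p0_nonneg: "0 \<le> q"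
proof -
  have 1: "1 \<in> {1..n}" using n2 by simp
  have "0 \<le> w 1 * q" using p0_solution(1) 1 unfolding admissible_def by blast
  then show ?thesis using weight_pos[OF 1] by (simp add: zero_le_mult_iff)
qed

text \<open>Each of the \<open>n\<close> summands is at most
  \<open>exp (- ((n - 1) / M * q))\<close> and they add up to 1, so this exponential is at least
  \<open>1 / n\<close>.\<close>

lemma p0_upper: "(real n - 1) * q \<le> M * ell"
proof -
  have "empty_prob N (w v * q) \<le> exp (- ((real n - 1) / M * q))" if v: "v \<in> {1..n}" for v
    using empty_prob_le_exp[OF N_pos, of "w v * q"] mult_right_mono[OF weight_bounds(1)[OF v] p0_nonneg]
    by (elim order_trans) simp
  then have "(\<Sum>v\<in>{1..n}. empty_prob N (w v * q)) \<le> (\<Sum>v\<in>{1..n}. exp (- ((real n - 1) / M * q)))"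
    by (rule sum_mono)
  then have "1 \<le> real n * exp (- ((real n - 1) / M * q))" unfolding sum_empty_prob_p0 by simp
  then have "exp ((real n - 1) / M * q) \<le> exp ell"
    using n2 by (simp add: exp_minus field_simps)
  then have "(real n - 1) / M * q \<le> ell" by simp
  then show ?thesis using M_ge_1 by (simp add: field_simps)
qed

lemma degree_p0_upper:
  assumes "v \<in> {1..n}"
  shows "w v * q \<le> ell * sqrt ell"
proof -
  have "w v * q \<le> (real n - 1) * M * q"
    using weight_bounds(2)[OF assms] p0_nonneg by (rule mult_right_mono)
  also have "\<dots> = M * ((real n - 1) * q)" by simp
  also have "\<dots> \<le> M * (M * ell)" using p0_upper M_ge_1 by (intro mult_left_mono) auto
  also have "\<dots> = ell * M\<^sup>2" by (simp add: power2_eq_square)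
  also have "\<dots> \<le> ell * sqrt ell" using M_sq_le ell_pos by (intro mult_left_mono) auto
  finally show ?thesis .
qed

lemma half_exp_le_empty_prob:
  assumes "0 \<le> t" "t \<le> ell * sqrt ell"
  shows "exp (- t) / 2 \<le> empty_prob N t"
proof -
  have "exp (- t) / 2 \<le> exp (- t) * exp (- 2 * (ell * sqrt ell)\<^sup>2 / real N)"
    using large_exp mult_left_mono[of "1 / 2" _ "exp (- t)"] by simp
  also have "\<dots> \<le> exp (- t) * exp (- 2 * t\<^sup>2 / real N)"
    using assms N_pos by (auto intro!: divide_right_mono power_mono)
  also have "\<dots> = exp (- t - 2 * t\<^sup>2 / real N)" by (simp flip: exp_add)
  also have "\<dots> \<le> empty_prob N t"
    using assms large_degree by (intro empty_prob_ge_exp) auto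
  finally show ?thesis .
qed

text \<open>Trades the defining equation of \<open>p0\<close> for exponentials, in which factors of
  \<open>p\<close> become powers. The 2 is the loss in \<open>half_exp_le_empty_prob\<close> and the
  origin of \<open>ln (n / 2)\<close> below.\<close>

lemma sum_exp_p0: "(\<Sum>v\<in>{1..n}. exp (- (w v * q))) \<le> 2"
proof -
  have "(\<Sum>v\<in>{1..n}. exp (- (w v * q)) / 2) \<le> (\<Sum>v\<in>{1..n}. empty_prob N (w v * q))"
    using p0_solution(1) degree_p0_upper
    by (intro sum_mono half_exp_le_empty_prob) (auto simp: admissible_def)
  then show ?thesis unfolding sum_divide_distrib[symmetric] sum_empty_prob_p0 by simp
qed

lemma p0_lower: "ln (real n / 2) \<le> (real n - 1) * M * q"
proof -
  have "(\<Sum>v\<in>{1..n}. exp (- ((real n - 1) * M * q))) \<le> (\<Sum>v\<in>{1..n}. exp (- (w v * q)))"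
    using weight_bounds(2) p0_nonneg by (intro sum_mono) (auto intro: mult_right_mono)
  then have "real n * exp (- ((real n - 1) * M * q)) \<le> 2" using sum_exp_p0 by simp
  moreover define t where "t = (real n - 1) * M * q"
  ultimately have "real n / 2 \<le> exp ((real n - 1) * M * q)"
    unfolding t_def[symmetric] by (simp add: exp_minus field_simps)
  then show ?thesis using n2 by (subst (asm) ln_le_cancel_iff[symmetric]) auto
qed

lemma lam_le: "lam n \<le> ln (real n / 2) / M\<^sup>2"
  unfolding lam_def using M_sq_le M_ge_1 n2 ell_pos
  by (intro divide_left_mono mult_pos_pos) auto

text \<open>\<open>p0_lower\<close> involves the largest possible degree \<open>(n - 1) * M\<close>;
  passing to the smallest, \<open>(n - 1) / M\<close>, costs \<open>M ^ 2\<close>, which is at most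
  \<open>sqrt ell\<close>.\<close>

lemma p0_lower_lam: "lam n \<le> (real n - 1) / M * q"
proof -
  have "lam n \<le> ((real n - 1) * M * q) / M\<^sup>2"
    using p0_lower by (intro order_trans[OF lam_le] divide_right_mono) auto
  also have "\<dots> = (real n - 1) / M * q"
    using M_ge_1 by (simp add: power2_eq_square field_simps)
  finally show ?thesis .
qed

lemma degree_p0_lower:
  assumes "v \<in> {1..n}"
  shows "lam n \<le> w v * q"
  using p0_lower_lam mult_right_mono[OF weight_bounds(1)[OF assms] p0_nonneg] by linarith

lemma Mq_le: "M * q \<le> ell * sqrt ell / (real n - 1)"
proof -
  have "(M * q) * (real n - 1) = M * ((real n - 1) * q)" by simp
  also have "\<dots> \<le> M * (M * ell)" using p0_upper M_ge_1 by (intro mult_left_mono) auto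
  also have "\<dots> = ell * M\<^sup>2" by (simp add: power2_eq_square)
  also have "\<dots> \<le> ell * sqrt ell" using M_sq_le ell_pos by (intro mult_left_mono) auto
  finally show ?thesis using n2 by (simp add: pos_le_divide_eq)
qed

text \<open>Lowering \<open>p\<close> from \<open>q\<close> multiplies each isolation probability by
  at least \<open>exp (\<epsilon> * lam n) / 2\<close>, hence the mean \<open>\<mu>\<close> as well.
  Distinct pairs are independent up to the factor \<open>\<eta>\<close>, so the second moment is at
  most \<open>\<mu> + \<eta> * \<mu> ^ 2\<close> and the bound becomes
  \<open>1 / \<mu> + \<eta> - 1\<close>.\<close>

lemma prob_connected_below:
  assumes \<epsilon>: "0 < \<epsilon>" "\<epsilon> < 1"
  shows "prob_connected n \<alpha> ((1 - \<epsilon>) * q) \<le>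
    2 * exp (- (\<epsilon> * lam n)) + exp (2 * (ell * sqrt ell / (real n - 1))) - 1"
proof -
  define p where "p = (1 - \<epsilon>) * q"
  define \<eta> where "\<eta> = exp (2 * (ell * sqrt ell / (real n - 1)))"
  have p: "0 \<le> p" "p \<le> q" using \<epsilon> p0_nonneg by (auto simp: p_def mult_left_le_one_le)
  have wp: "0 \<le> w v * p" "w v * p \<le> w v * q" if "v \<in> {1..n}" for v
    using weight_pos[OF that] p by (auto intro: mult_left_mono)
  have wp': "w v * p \<le> ell * sqrt ell" if "v \<in> {1..n}" for v
    using wp(2)[OF that] degree_p0_upper[OF that] by simp
  let ?e = "\<lambda>v. empty_prob N (w v * p)"
  define \<mu> where "\<mu> = (\<Sum>v\<in>{1..n}. ?e v)"
  have "exp (\<epsilon> * lam n) / 2 * empty_prob N (w v * q) \<le> ?e v" if v: "v \<in> {1..n}" for v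
  proof -
    have "exp (\<epsilon> * lam n) / 2 * empty_prob N (w v * q) \<le> exp (\<epsilon> * (w v * q)) / 2 * exp (- (w v * q))"
      using degree_p0_lower[OF v] \<epsilon> empty_prob_le_exp[OF N_pos] by (intro mult_mono) auto
    also have "\<dots> = exp (- (w v * p)) / 2"
      by (simp add: p_def algebra_simps flip: exp_add)
    also have "\<dots> \<le> ?e v" using wp(1)[OF v] wp'[OF v] by (rule half_exp_le_empty_prob)
    finally show ?thesis .
  qed
  then have "(\<Sum>v\<in>{1..n}. exp (\<epsilon> * lam n) / 2 * empty_prob N (w v * q)) \<le> \<mu>"
    unfolding \<mu>_def by (rule sum_mono)
  then have \<mu>: "exp (\<epsilon> * lam n) / 2 \<le> \<mu>"
    unfolding sum_distrib_left[symmetric] sum_empty_prob_p0 by simp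
  have \<mu>_pos: "0 < \<mu>" using \<mu> by (rule less_le_trans[rotated]) simp
  have pair: "empty_prob N (sum \<alpha> (edge_cut n {v} \<union> edge_cut n {u}) * p) \<le>
      (if u = v then ?e v else 0) + \<eta> * (?e v * ?e u)" if v: "v \<in> {1..n}" and u: "u \<in> {1..n}" for u v
  proof (cases "u = v")
    case True
    then show ?thesis using v by (simp add: vertex_weight_eq[symmetric] \<eta>_def)
  next
    case False
    have "0 \<le> 1 / M" using M_ge_1 by simp
    then have d: "0 \<le> \<alpha> {v, u} * p"
      using edge_weight_bounds(1)[OF v u False] p by (intro mult_nonneg_nonneg) linarith+
    have "\<alpha> {v, u} * p \<le> M * q"
      using edge_weight_bounds(2)[OF v u False] M_ge_1 p by (intro mult_mono) auto
    then have d2: "\<alpha> {v, u} * p \<le> ell * sqrt ell / (real n - 1)" using Mq_le by linarith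
    have "empty_prob N (sum \<alpha> (edge_cut n {v} \<union> edge_cut n {u}) * p) =
        empty_prob N (w v * p + w u * p - \<alpha> {v, u} * p)"
      using False by (subst sum_cut_pair[OF v u]) (auto simp: algebra_simps)
    also have "\<dots> \<le> exp (2 * (\<alpha> {v, u} * p)) * (?e v * ?e u)"
      using wp(1)[OF u] wp(1)[OF v] wp'[OF u] wp'[OF v] large_degree d N_pos
      by (intro empty_prob_sub_le) linarith+
    also have "\<dots> \<le> \<eta> * (?e v * ?e u)"
      using d2 unfolding \<eta>_def by (intro mult_right_mono mult_nonneg_nonneg) auto
    finally show ?thesis using False by simp
  qed
  have sum_pairs: "(\<Sum>v\<in>{1..n}. \<Sum>u\<in>{1..n}. \<eta> * (?e v * ?e u)) = \<eta> * \<mu>\<^sup>2"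
    unfolding \<mu>_def power2_eq_square sum_product by (simp only: sum_distrib_left)
  have "prob_connected n \<alpha> p \<le> prob_no_isolated p" by (rule prob_connected_le_no_isolated)
  also have "\<dots> \<le> (\<Sum>v\<in>{1..n}. \<Sum>u\<in>{1..n}.
      empty_prob N (sum \<alpha> (edge_cut n {v} \<union> edge_cut n {u}) * p)) / \<mu>\<^sup>2 - 1"
    unfolding \<mu>_def by (rule prob_no_isolated_second_moment[OF p(1)]) (use \<mu>_pos in \<open>simp add: \<mu>_def\<close>)
  also have "\<dots> \<le> (\<Sum>v\<in>{1..n}. \<Sum>u\<in>{1..n}. (if u = v then ?e v else 0) + \<eta> * (?e v * ?e u)) / \<mu>\<^sup>2 - 1"
    using pair by (intro diff_right_mono divide_right_mono sum_mono) auto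
  also have "(\<Sum>v\<in>{1..n}. \<Sum>u\<in>{1..n}. (if u = v then ?e v else 0) + \<eta> * (?e v * ?e u)) = \<mu> + \<eta> * \<mu>\<^sup>2"
    unfolding sum.distrib sum_pairs by (simp add: \<mu>_def)
  also have "(\<mu> + \<eta> * \<mu>\<^sup>2) / \<mu>\<^sup>2 = 1 / \<mu> + \<eta>"
    using \<mu>_pos by (simp add: field_simps power2_eq_square)
  also have "1 / \<mu> \<le> 1 / (exp (\<epsilon> * lam n) / 2)"
    using \<mu> by (intro divide_left_mono mult_pos_pos \<mu>_pos) auto
  also have "\<dots> = 2 * exp (- (\<epsilon> * lam n))" by (simp add: exp_minus field_simps)
  finally show ?thesis by (simp add: p_def \<eta>_def)
qed

text \<open>Up to \<open>K\<close> vertices the boundary of a set is compared with its total degree, and the union bound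
  becomes a product over the vertices; beyond \<open>K\<close> the crude bound \<open>\<alpha>\<^sub>e \<ge> 1 / M\<close> beats the
  number of sets.\<close>
lemma prob_connected_above:
  assumes \<epsilon>: "0 < \<epsilon>" "\<epsilon> \<le> 1"
  defines "\<beta> \<equiv> exp (1 + sqrt ell / 8 - lam n / 2)"
  assumes \<beta>: "\<beta> < 1"
  shows "1 - prob_connected n \<alpha> ((1 + \<epsilon>) * q) \<le>
    exp (2 * exp 1 * exp (- (\<epsilon> * lam n))) - 1 + \<beta> / (1 - \<beta>)"
proof -
  define p where "p = (1 + \<epsilon>) * q"
  \<comment> \<open>Two demands meet here. \<open>K * (M * p) \<le> 1\<close> follows from
    \<open>large_split\<close>; and for \<open>k > K\<close> the ratio \<open>n / k\<close> is below
    \<open>exp (sqrt ell / 8)\<close>, whose exponent is asymptotically smaller than the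
    \<open>lam n / 2\<close> available per vertex.\<close>
  define K where "K = real n * exp (- sqrt ell / 8)"
  have p: "0 \<le> p" "q \<le> p" "p \<le> 2 * q"
    using \<epsilon> p0_nonneg mult_right_mono[of \<epsilon> 1 q] by (auto simp: p_def algebra_simps)
  have "K * (M * p) \<le> K * (2 * (ell * sqrt ell / (real n - 1)))"
  proof (rule mult_left_mono)
    have "M * p \<le> M * (2 * q)" using p(3) M_ge_1 by (intro mult_left_mono) auto
    then show "M * p \<le> 2 * (ell * sqrt ell / (real n - 1))" using Mq_le by linarith
  qed (simp add: K_def)
  also have "\<dots> \<le> 1" using large_split by (simp add: K_def mult_ac)
  finally have KMp: "K * (M * p) \<le> 1" .
  \<comment> \<open>The factor \<open>exp 1\<close> pays for the edges inside \<open>S\<close>: for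
    \<open>card S \<le> K\<close> they account for at most
    \<open>(card S) ^ 2 * M * p \<le> card S\<close> in the exponent.\<close>
  define y where "y v = exp 1 * exp (- (w v * p))" for v
  have y: "0 \<le> y v" for v by (simp add: y_def)
  have sum_y: "(\<Sum>v\<in>{1..n}. y v) \<le> 2 * exp 1 * exp (- (\<epsilon> * lam n))"
  proof -
    have "(\<Sum>v\<in>{1..n}. y v) \<le> (\<Sum>v\<in>{1..n}. (exp 1 * exp (- (\<epsilon> * lam n))) * exp (- (w v * q)))"
    proof (rule sum_mono)
      fix v assume v: "v \<in> {1..n}"
      have "exp (- (w v * p)) = exp (- (\<epsilon> * (w v * q))) * exp (- (w v * q))"
        by (simp add: p_def algebra_simps flip: exp_add)
      also have "\<dots> \<le> exp (- (\<epsilon> * lam n)) * exp (- (w v * q))"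
        using degree_p0_lower[OF v] \<epsilon> by (intro mult_right_mono) auto
      finally show "y v \<le> (exp 1 * exp (- (\<epsilon> * lam n))) * exp (- (w v * q))"
        by (simp add: y_def)
    qed
    also have "\<dots> \<le> (exp 1 * exp (- (\<epsilon> * lam n))) * 2"
      unfolding sum_distrib_left[symmetric] using sum_exp_p0 by (intro mult_left_mono) auto
    finally show ?thesis by (simp add: mult_ac)
  qed
  let ?t = "\<lambda>S. empty_prob N (sum \<alpha> (edge_cut n S) * p)"
  let ?A = "{S \<in> small_sets n. real (card S) \<le> K}" and ?B = "{S \<in> small_sets n. K < real (card S)}"
  have A: "?t S \<le> (\<Prod>v\<in>S. y v)" if S: "S \<in> ?A" for S
  proof -
    have S': "S \<subseteq> {1..n}" "finite S" using S finite_subset by (auto simp: small_sets_def)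
    have "real (card S) * (real (card S) * (M * p)) \<le> real (card S) * 1"
    proof (rule mult_left_mono)
      have "real (card S) * (M * p) \<le> K * (M * p)" using S M_ge_1 p by (intro mult_right_mono) auto
      then show "real (card S) * (M * p) \<le> 1" using KMp by linarith
    qed simp
    then have c: "(real (card S))\<^sup>2 * M * p \<le> real (card S)" by (simp add: power2_eq_square mult_ac)
    have "((\<Sum>v\<in>S. w v) - (real (card S))\<^sup>2 * M) * p \<le> sum \<alpha> (edge_cut n S) * p"
      using M_ge_1 p by (intro mult_right_mono sum_cut_ge[OF S'(1) bounded]) auto
    moreover have "(\<Sum>v\<in>S. 1 + - (w v * p)) = real (card S) - (\<Sum>v\<in>S. w v) * p"
      by (simp add: sum_subtractf sum_distrib_right)
    ultimately have "- (sum \<alpha> (edge_cut n S) * p) \<le> (\<Sum>v\<in>S. 1 + - (w v * p))"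
      using c by (simp add: algebra_simps)
    then have "exp (- (sum \<alpha> (edge_cut n S) * p)) \<le> exp (\<Sum>v\<in>S. 1 + - (w v * p))" by simp
    also have "\<dots> = (\<Prod>v\<in>S. y v)" using S'(2) by (simp add: exp_sum y_def exp_diff exp_minus divide_inverse)
    finally show ?thesis using empty_prob_le_exp[OF N_pos] order_trans by blast
  qed
  have B: "?t S \<le> exp (- (real (card S) * lam n / 2))" if S: "S \<in> ?B" for S
  proof -
    have S': "S \<subseteq> {1..n}" "2 * card S \<le> n" using S by (auto simp: small_sets_def)
    \<comment> \<open>At least half of the vertices lie outside \<open>S\<close>.\<close>
    have "real (card S) * (real n / 2) \<le> real (card S) * real (n - card S)"
      using S' by (intro mult_left_mono) (auto simp: of_nat_diff)
    then have c: "real (card S) * (real n / 2) \<le> real (card (edge_cut n S))"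
      using S' by (simp add: card_cut)
    have "real (card S) * lam n / 2 \<le> real (card S) * ((real n - 1) / M * q) / 2"
      using p0_lower_lam by (intro divide_right_mono mult_left_mono) auto
    also have "\<dots> \<le> real (card S) * (real n / M * p) / 2"
      using p p0_nonneg M_ge_1 n2 by (intro divide_right_mono mult_left_mono mult_mono) auto
    also have "\<dots> = real (card S) * (real n / 2) * (1 / M) * p" by simp
    also have "\<dots> \<le> real (card (edge_cut n S)) * (1 / M) * p"
      using c p M_ge_1 by (intro mult_right_mono) auto
    also have "\<dots> \<le> sum \<alpha> (edge_cut n S) * p"
    proof (rule mult_right_mono)
      have "(\<Sum>e\<in>edge_cut n S. 1 / M) \<le> sum \<alpha> (edge_cut n S)"
        using bounded cut_subset by (intro sum_mono) (auto simp: M_bounded_def)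
      then show "real (card (edge_cut n S)) * (1 / M) \<le> sum \<alpha> (edge_cut n S)" by simp
    qed (rule p)
    finally have "exp (- (sum \<alpha> (edge_cut n S) * p)) \<le> exp (- (real (card S) * lam n / 2))" by simp
    then show ?thesis using empty_prob_le_exp[OF N_pos] order_trans by blast
  qed
  have "1 - prob_connected n \<alpha> p \<le> (\<Sum>S\<in>small_sets n. ?t S)"
    by (rule prob_not_connected_le[OF p(1)])
  also have "small_sets n = ?A \<union> ?B" by auto
  also have "(\<Sum>S\<in>?A \<union> ?B. ?t S) = (\<Sum>S\<in>?A. ?t S) + (\<Sum>S\<in>?B. ?t S)"
    by (rule sum.union_disjoint) auto
  also have "(\<Sum>S\<in>?A. ?t S) \<le> (\<Sum>S\<in>?A. \<Prod>v\<in>S. y v)" using A by (rule sum_mono)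
  also have "\<dots> \<le> (\<Sum>S\<in>Pow {1..n} - {{}}. \<Prod>v\<in>S. y v)"
    by (intro sum_mono2) (auto simp: small_sets_def intro: prod_nonneg y)
  also have "\<dots> \<le> exp (\<Sum>v\<in>{1..n}. y v) - 1"
    by (rule sum_nonempty_subsets_prod_le) (auto simp: y)
  also have "\<dots> \<le> exp (2 * exp 1 * exp (- (\<epsilon> * lam n))) - 1" using sum_y by simp
  also have "(\<Sum>S\<in>?B. ?t S) \<le> (\<Sum>S\<in>?B. exp (- (real (card S) * lam n / 2)))"
    using B by (rule sum_mono)
  also have "\<dots> \<le> (\<Sum>S | S \<subseteq> {1..n} \<and> K < real (card S). exp (- (real (card S) * lam n / 2)))"
    by (intro sum_mono2) (auto simp: small_sets_def)
  also have "\<dots> = (\<Sum>k | k \<le> n \<and> K < real k. real (n choose k) * exp (- (real k * lam n / 2)))"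
    using sum_subsets_by_card[where A = "{1..n}" and P = "\<lambda>k. K < real k"] by simp
  also have "\<dots> \<le> (\<Sum>k | k \<le> n \<and> K < real k. \<beta> ^ k)"
  proof (rule sum_mono)
    fix k assume k: "k \<in> {k. k \<le> n \<and> K < real k}"
    have K0: "0 < K" using n2 by (simp add: K_def)
    then have k0: "0 < k" using k by (cases k) auto
    have "real n / real k \<le> real n / K"
      using k k0 K0 by (intro divide_left_mono mult_pos_pos) auto
    also have "\<dots> = exp (sqrt ell / 8)" using n2 by (simp add: K_def exp_minus inverse_eq_divide)
    finally have nk: "real n / real k \<le> exp (sqrt ell / 8)" .
    have "real (n choose k) \<le> (exp 1 * (real n / real k)) ^ k"
      using binomial_le_exp_power[OF k0, of n] by simp
    also have "\<dots> \<le> (exp 1 * exp (sqrt ell / 8)) ^ k"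
      using nk by (intro power_mono mult_left_mono) auto
    finally have "real (n choose k) * exp (- (real k * lam n / 2)) \<le>
        (exp 1 * exp (sqrt ell / 8)) ^ k * exp (real k * (- (lam n / 2)))"
      by (simp add: mult_right_mono)
    also have "\<dots> = \<beta> ^ k"
      unfolding exp_of_nat_mult power_mult_distrib[symmetric] \<beta>_def by (simp flip: exp_add)
    finally show "real (n choose k) * exp (- (real k * lam n / 2)) \<le> \<beta> ^ k" .
  qed
  also have "\<dots> \<le> (\<Sum>k\<in>{1..n}. \<beta> ^ k)"
  proof (rule sum_mono2)
    have "0 < K" using n2 by (simp add: K_def)
    then show "{k. k \<le> n \<and> K < real k} \<subseteq> {1..n}" by (auto simp: Suc_le_eq intro: gr0I)
  qed (auto simp: \<beta>_def)
  also have "\<dots> = \<beta> * (\<Sum>k<n. \<beta> ^ k)"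
    unfolding sum_distrib_left
    using sum.atLeast1_atMost_eq[of "\<lambda>k. \<beta> ^ k" n] by simp
  also have "\<dots> \<le> \<beta> * (1 / (1 - \<beta>))"
  proof (rule mult_left_mono)
    have "(\<Sum>k<n. \<beta> ^ k) = (1 - \<beta> ^ n) / (1 - \<beta>)" using \<beta> by (simp add: sum_gp_strict)
    also have "\<dots> \<le> 1 / (1 - \<beta>)" using \<beta> by (intro divide_right_mono) (auto simp: \<beta>_def)
    finally show "(\<Sum>k<n. \<beta> ^ k) \<le> 1 / (1 - \<beta>)" .
  qed (simp add: \<beta>_def)
  finally show ?thesis by (simp add: p_def)
qed

end

section \<open>Unit weights\<close>

locale unit_graph = simplex_graph +
  assumes unit: "\<And>e. e \<in> edge_set n \<Longrightarrow> \<alpha> e = 1"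
begin

lemma sum_unit: "S \<subseteq> edge_set n \<Longrightarrow> sum \<alpha> S = real (card S)"
  using unit by (simp add: subset_iff)

text \<open>The degree sum \<open>k * (n - 1)\<close> less the \<open>k * (k - 1) / 2\<close> pairs
  counted twice, written in the form \<open>k * (n - b)\<close> of the limit lemmas.\<close>

lemma card_Union_cut_real:
  assumes "W \<subseteq> {1..n}"
  shows "real (card (\<Union>v\<in>W. edge_cut n {v})) =
    real (card W) * (real n - (real (card W) + 1) / 2)"
proof -
  have k: "card W \<le> n" using card_mono[OF _ assms] by simp
  have "(n - card W) choose 2 \<le> n choose 2" by (rule binomial_right_mono) simp
  then show ?thesis
    using k by (simp add: card_Union_cut[OF assms] of_nat_diff real_choose_2) (simp add: field_simps)
qed

lemma prob_no_isolated_unit: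
  assumes "0 \<le> p"
  shows "prob_no_isolated p = (\<Sum>k\<le>n. real (n choose k) *
    ((- 1) ^ k * empty_prob N (real k * (real n - (real k + 1) / 2) * p)))"
proof -
  have sub: "(\<Union>v\<in>W. edge_cut n {v}) \<subseteq> edge_set n" for W using cut_subset by blast
  have "prob_no_isolated p = (\<Sum>W | W \<subseteq> {1..n} \<and> True.
      (- 1) ^ card W * empty_prob N (real (card W) * (real n - (real (card W) + 1) / 2) * p))"
    unfolding prob_no_isolated_eq[OF assms]
  proof (rule sum.cong)
    fix W assume "W \<in> {W. W \<subseteq> {1..n} \<and> True}"
    then have W: "W \<subseteq> {1..n}" by simp
    show "(- 1) ^ card W * empty_prob N (sum \<alpha> (\<Union>v\<in>W. edge_cut n {v}) * p) =
        (- 1) ^ card W * empty_prob N (real (card W) * (real n - (real (card W) + 1) / 2) * p)"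
      by (simp only: sum_unit[OF sub] card_Union_cut_real[OF W])
  qed auto
  also have "\<dots> = (\<Sum>k | k \<le> n \<and> True. real (n choose k) *
      ((- 1) ^ k * empty_prob N (real k * (real n - (real k + 1) / 2) * p)))"
    using sum_subsets_by_card[where A = "{1..n}" and P = "\<lambda>_. True" and
        g = "\<lambda>k. (- 1) ^ k * empty_prob N (real k * (real n - (real k + 1) / 2) * p)"] by simp
  finally show ?thesis by (simp add: atMost_def)
qed

text \<open>A set of \<open>k\<close> vertices contains at most \<open>k * k\<close> edges, each
  contributing the gain \<open>2 * p\<close> of \<open>empty_prob_diff_le\<close>. The hypotheses
  keep \<open>p\<close> and the boundary exponent within the range of that lemma.\<close>

lemma prob_no_isolated_le_unit:
  assumes p: "0 \<le> p" "2 * p \<le> real N" "real n * real n * p \<le> 2 * real N"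
  shows "prob_no_isolated p \<le> prob_connected n \<alpha> p +
    (\<Sum>k | k \<le> n \<and> 2 \<le> k \<and> 2 * k \<le> n. real (n choose k) *
      (real k * real k * (2 * p) * exp (- (real k * (real n - real k) * p))))"
proof -
  have "(\<Sum>S\<in>{S \<in> small_sets n. 2 \<le> card S}. \<Sum>e\<in>{e \<in> edge_set n. e \<subseteq> S}.
      empty_prob N (sum \<alpha> (edge_cut n S) * p) - empty_prob N ((sum \<alpha> (edge_cut n S) + \<alpha> e) * p)) \<le>
    (\<Sum>S | S \<subseteq> {1..n} \<and> 2 \<le> card S \<and> 2 * card S \<le> n.
      real (card S) * real (card S) * (2 * p) * exp (- (real (card S) * (real n - real (card S)) * p)))"
    (is "?L \<le> ?R")
  proof -
    have eq: "{S \<in> small_sets n. 2 \<le> card S} = {S. S \<subseteq> {1..n} \<and> 2 \<le> card S \<and> 2 * card S \<le> n}"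
      by (auto simp: small_sets_def)
    show ?thesis
      unfolding eq
    proof (rule sum_mono)
      fix S assume "S \<in> {S. S \<subseteq> {1..n} \<and> 2 \<le> card S \<and> 2 * card S \<le> n}"
      then have S: "S \<subseteq> {1..n}" "2 * card S \<le> n" by auto
      let ?k = "real (card S)"
      define t where "t = ?k * (real n - ?k) * p"
      have cut: "sum \<alpha> (edge_cut n S) = ?k * (real n - ?k)"
        using S by (simp add: sum_unit cut_subset card_cut of_nat_diff)
      \<comment> \<open>\<open>4 * k * (n - k) \<le> n ^ 2\<close> is the nonnegativity of
        \<open>(n - 2 * k) ^ 2\<close>.\<close>
      have "4 * t \<le> real n * real n * p"
      proof -
        have "0 \<le> (real n - 2 * ?k) * (real n - 2 * ?k) * p" using p(1) by simp
        then show ?thesis by (simp add: t_def algebra_simps)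
      qed
      then have t: "2 * t \<le> real N" using p(3) by simp
      have "empty_prob N t - empty_prob N (t + p) \<le> 2 * p * empty_prob N t"
        by (rule empty_prob_diff_le[OF p(1) p(2) t N_pos])
      also have "\<dots> \<le> 2 * p * exp (- t)"
        using p(1) by (intro mult_left_mono empty_prob_le_exp[OF N_pos]) auto
      finally have diff: "empty_prob N t - empty_prob N (t + p) \<le> 2 * p * exp (- t)" .
      have "(\<Sum>e\<in>{e \<in> edge_set n. e \<subseteq> S}. empty_prob N (sum \<alpha> (edge_cut n S) * p) -
          empty_prob N ((sum \<alpha> (edge_cut n S) + \<alpha> e) * p)) =
        (\<Sum>e\<in>{e \<in> edge_set n. e \<subseteq> S}. empty_prob N t - empty_prob N (t + p))"
        by (rule sum.cong) (auto simp: cut t_def unit algebra_simps)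
      also have "\<dots> \<le> (\<Sum>e\<in>{e \<in> edge_set n. e \<subseteq> S}. 2 * p * exp (- t))"
        using diff by (intro sum_mono)
      also have "\<dots> = real (card {e \<in> edge_set n. e \<subseteq> S}) * (2 * p * exp (- t))" by simp
      also have "\<dots> \<le> ?k * ?k * (2 * p * exp (- t))"
      proof (rule mult_right_mono)
        have "{e \<in> edge_set n. e \<subseteq> S} = {e. e \<subseteq> S \<and> card e = 2}"
          using S(1) by (auto simp: edge_set_def)
        then have "real (card {e \<in> edge_set n. e \<subseteq> S}) = ?k * (?k - 1) / 2"
          using finite_subset[OF S(1)] by (simp add: n_subsets real_choose_2)
        also have "\<dots> \<le> ?k * ?k" by (simp add: algebra_simps)
        finally show "real (card {e \<in> edge_set n. e \<subseteq> S}) \<le> ?k * ?k" .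
      qed (use p in simp)
      finally show "(\<Sum>e\<in>{e \<in> edge_set n. e \<subseteq> S}. empty_prob N (sum \<alpha> (edge_cut n S) * p) -
          empty_prob N ((sum \<alpha> (edge_cut n S) + \<alpha> e) * p)) \<le>
        ?k * ?k * (2 * p) * exp (- (?k * (real n - ?k) * p))" by (simp add: t_def mult_ac)
    qed
  qed
  also have "?R = (\<Sum>k | k \<le> n \<and> 2 \<le> k \<and> 2 * k \<le> n. real (n choose k) *
      (real k * real k * (2 * p) * exp (- (real k * (real n - real k) * p))))"
    using sum_subsets_by_card[where A = "{1..n}" and P = "\<lambda>k. 2 \<le> k \<and> 2 * k \<le> n" and
        g = "\<lambda>k. real k * real k * (2 * p) * exp (- (real k * (real n - real k) * p))"] by simp
  finally show ?thesis using prob_no_isolated_le[OF p(1)] by linarith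
qed

end

section \<open>Limits in the critical window\<close>

definition crit :: "real \<Rightarrow> nat \<Rightarrow> real" where
  "crit c n = (ln (real n) + c) / real n"

text \<open>The uniform domination for Tannery's theorem. The slack \<open>m\<close> covers two
  sums: \<open>m = k / 2\<close> for inclusion-exclusion, where \<open>k\<close> runs up to
  \<open>n\<close>, and \<open>m = k\<close> for components, where \<open>2 * k \<le> n\<close>. The
  ratio \<open>\<delta>\<close> is free so that polynomial factors can be absorbed.\<close>

lemma binomial_exp_dominated:
  assumes \<delta>: "0 < \<delta>"
  shows "\<exists>n0. \<forall>n\<ge>n0. \<forall>k\<ge>n0. \<forall>m. 0 \<le> m \<and> m \<le> real k \<and> 2 * m \<le> real n \<longrightarrow>
    real (n choose k) * exp (- (real k * (real n - m - 1) * crit c n)) \<le> \<delta> ^ k"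
proof -
  have ev: "\<forall>\<^sub>F n in sequentially. 0 \<le> crit c n" "\<forall>\<^sub>F n in sequentially. crit c n \<le> 1"
    "\<forall>\<^sub>F n in sequentially. c \<le> ln (real n)" "\<forall>\<^sub>F n in sequentially. 0 < ln (real n)"
    "\<forall>\<^sub>F n in sequentially. 0 < n"
    unfolding crit_def by real_asymp+
  have "((\<lambda>n. exp (2 - c) * (exp ((ln (real n) + c) / 2) * (ln (real n) / real n))) \<longlongrightarrow> 0) sequentially"
    by real_asymp
  then have "\<forall>\<^sub>F n in sequentially. exp (2 - c) * (exp ((ln (real n) + c) / 2) * (ln (real n) / real n)) < \<delta>"
    using \<delta> by (rule order_tendstoD)
  with ev have "\<forall>\<^sub>F n in sequentially. 0 \<le> crit c n \<and> crit c n \<le> 1 \<and> c \<le> ln (real n) \<and> 0 < ln (real n) \<and>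
      0 < n \<and> exp (2 - c) * (exp ((ln (real n) + c) / 2) * (ln (real n) / real n)) < \<delta>"
    by eventually_elim auto
  then obtain n1 where n1: "\<And>n. n1 \<le> n \<Longrightarrow> 0 \<le> crit c n \<and> crit c n \<le> 1 \<and> c \<le> ln (real n) \<and> 0 < ln (real n) \<and>
      0 < n \<and> exp (2 - c) * (exp ((ln (real n) + c) / 2) * (ln (real n) / real n)) < \<delta>"
    unfolding eventually_sequentially by blast
  \<comment> \<open>For moderate \<open>k\<close> the \<open>k\<close>-th root of the term is
    bounded by \<open>exp 2 / k * exp (2 - c) = exp (4 - c) / k\<close>, which has to fall below
    \<open>\<delta>\<close>.\<close>
  obtain K where K: "exp (4 - c) / \<delta> < real K" using reals_Archimedean2 by blast
  have "real (n choose k) * exp (- (real k * (real n - m - 1) * crit c n)) \<le> \<delta> ^ k"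
    if n: "n1 \<le> n" and k: "K \<le> k" and m: "0 \<le> m" "m \<le> real k" "2 * m \<le> real n" for n k m
  proof -
    let ?p = "crit c n"
    note n1[OF n]
    then have p: "0 \<le> ?p" "?p \<le> 1" and c: "c \<le> ln (real n)" and l: "0 < ln (real n)" and n0: "0 < n"
      and small: "exp (2 - c) * (exp ((ln (real n) + c) / 2) * (ln (real n) / real n)) < \<delta>" by auto
    have "0 < exp (4 - c) / \<delta>" using \<delta> by simp
    then have k0: "0 < k" using K k by linarith
    \<comment> \<open>The left side bounds the \<open>k\<close>-th root of the term: one
      \<open>exp 1\<close> stems from the binomial, one from the shift by 1, and
      \<open>exp (- c)\<close> from \<open>n * ?p = ln n + c\<close>. If
      \<open>k \<le> n / ln n\<close>, then \<open>m * ?p\<close> is at most 2 and large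
      \<open>k\<close> suffices. Otherwise \<open>2 * m \<le> n\<close> lets
      \<open>exp (m * ?p)\<close> grow only like the square root of \<open>n\<close>, while
      \<open>1 / k\<close> is below \<open>ln n / n\<close>.\<close>
    have "exp (m * ?p) / real k * exp (2 - c) \<le> \<delta>"
    proof (cases "real k * ln (real n) \<le> real n")
      case True
      have "m * ?p \<le> real k * (2 * ln (real n) / real n)"
        using m p c unfolding crit_def by (intro mult_mono divide_right_mono) auto
      also have "\<dots> \<le> 2" using True n0 by (simp add: field_simps)
      finally have "exp (m * ?p) / real k * exp (2 - c) \<le> exp 2 / real k * exp (2 - c)"
        by (intro mult_right_mono divide_right_mono) auto
      also have "\<dots> = exp (4 - c) / real k" by (simp flip: exp_add)
      also have "\<dots> \<le> \<delta>"
      proof -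
        have "exp (4 - c) \<le> real K * \<delta>" using K \<delta> by (simp add: field_simps)
        also have "\<dots> \<le> real k * \<delta>" using k \<delta> by (intro mult_right_mono) auto
        finally show ?thesis using k0 by (simp add: field_simps)
      qed
      finally show ?thesis .
    next
      case False
      have "m * ?p \<le> real n / 2 * ?p" using m p by (intro mult_right_mono) auto
      also have "\<dots> = (ln (real n) + c) / 2" using n0 by (simp add: crit_def)
      finally have e: "exp (m * ?p) \<le> exp ((ln (real n) + c) / 2)" by simp
      have "1 / real k \<le> ln (real n) / real n"
        using False n0 k0 by (simp add: field_simps)
      then have "exp (m * ?p) * (1 / real k) \<le> exp ((ln (real n) + c) / 2) * (ln (real n) / real n)"
        using e by (intro mult_mono) auto
      then have "exp (2 - c) * (exp (m * ?p) * (1 / real k)) \<le>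
          exp (2 - c) * (exp ((ln (real n) + c) / 2) * (ln (real n) / real n))"
        by (intro mult_left_mono) auto
      then show ?thesis using small by (simp add: mult_ac)
    qed
    have np: "real n * ?p = ln (real n) + c" using n0 by (simp add: crit_def)
    have "exp (- ((real n - m - 1) * ?p)) = exp (- (real n * ?p) + m * ?p + ?p)"
      by (simp add: algebra_simps)
    also have "\<dots> = exp (- c) / real n * exp (m * ?p) * exp ?p"
      unfolding np using n0 by (simp add: exp_add exp_diff exp_minus field_simps)
    also have "\<dots> \<le> exp (- c) / real n * exp (m * ?p) * exp 1"
      using p n0 by (intro mult_left_mono) auto
    finally have E: "exp (- ((real n - m - 1) * ?p)) \<le> exp (- c) / real n * exp (m * ?p) * exp 1" .
    have "real (n choose k) * exp (- (real k * (real n - m - 1) * ?p)) \<le>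
        (exp 1 * real n / real k) ^ k * exp (real k * (- ((real n - m - 1) * ?p)))"
      using binomial_le_exp_power[OF k0, of n] by (simp add: mult_right_mono mult_ac)
    also have "\<dots> = (exp 1 * real n / real k * exp (- ((real n - m - 1) * ?p))) ^ k"
      by (simp only: exp_of_nat_mult power_mult_distrib)
    also have "\<dots> \<le> (exp 1 * real n / real k * (exp (- c) / real n * exp (m * ?p) * exp 1)) ^ k"
      using E by (intro power_mono mult_left_mono) auto
    also have "exp 1 * real n / real k * (exp (- c) / real n * exp (m * ?p) * exp 1) =
        exp (m * ?p) / real k * (exp 1 * exp 1 * exp (- c))"
      using n0 by (simp add: field_simps)
    also have "exp 1 * exp 1 * exp (- c) = exp (2 - c)" by (simp flip: exp_add)
    also have "(exp (m * ?p) / real k * exp (2 - c)) ^ k \<le> \<delta> ^ k"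
      by (intro power_mono) (fact, simp)
    finally show ?thesis .
  qed
  then show ?thesis by (intro exI[of _ "max n1 K"]) auto
qed

lemma tendsto_binomial_div_power: "(\<lambda>n. real (n choose k) / real n ^ k) \<longlonglongrightarrow> 1 / fact k"
proof -
  have "(\<lambda>n. (\<Prod>i = 0..<k. (real n - real i) / real n) / fact k) \<longlonglongrightarrow> (\<Prod>i = 0..<k. 1) / fact k"
    by (intro tendsto_divide tendsto_prod tendsto_const) (real_asymp, simp)
  also have "(\<lambda>n. (\<Prod>i = 0..<k. (real n - real i) / real n) / fact k) = (\<lambda>n. real (n choose k) / real n ^ k)"
    by (simp add: binomial_gbinomial gbinomial_prod_rev prod_dividef fun_eq_iff)
  finally show ?thesis by simp
qed

text \<open>Writing \<open>n ^ k\<close> as \<open>exp (k * ln n)\<close> cancels the logarithm and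
  leaves \<open>- k * c\<close>; the shift \<open>b\<close> adds only
  \<open>k * b * crit c n\<close>, which tends to 0.\<close>

lemma tendsto_power_mult_exp_crit:
  fixes b c :: real
  shows "(\<lambda>n. real n ^ k * exp (- (real k * (real n - b) * crit c n))) \<longlonglongrightarrow> exp (- c) ^ k"
proof -
  have "(\<lambda>n. exp (real k * (ln (real n) - (real n - b) * ((ln (real n) + c) / real n)))) \<longlonglongrightarrow>
      exp (real k * - c)"
    by (intro tendsto_exp tendsto_mult tendsto_const) real_asymp
  moreover have "\<forall>\<^sub>F n in sequentially.
      exp (real k * (ln (real n) - (real n - b) * ((ln (real n) + c) / real n))) =
      real n ^ k * exp (- (real k * (real n - b) * crit c n))"
    using eventually_gt_at_top[of 0]
  proof eventually_elim
    case (elim n)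
    have "real n ^ k = exp (real k * ln (real n))" using elim by (simp add: exp_of_nat_mult)
    then show ?case by (simp add: crit_def right_diff_distrib mult.assoc flip: exp_add)
  qed
  ultimately show ?thesis
    unfolding exp_of_nat_mult[symmetric] by (rule Lim_transform_eventually)
qed

lemma tendsto_binomial_exp_crit:
  fixes b c :: real
  shows "(\<lambda>n. real (n choose k) * exp (- (real k * (real n - b) * crit c n))) \<longlonglongrightarrow> exp (- c) ^ k / fact k"
proof -
  have "(\<lambda>n. (real (n choose k) / real n ^ k) *
      (real n ^ k * exp (- (real k * (real n - b) * crit c n)))) \<longlonglongrightarrow> 1 / fact k * exp (- c) ^ k"
    by (intro tendsto_mult tendsto_binomial_div_power tendsto_power_mult_exp_crit)
  moreover have "\<forall>\<^sub>F n in sequentially. (real (n choose k) / real n ^ k) *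
      (real n ^ k * exp (- (real k * (real n - b) * crit c n))) =
      real (n choose k) * exp (- (real k * (real n - b) * crit c n))"
    using eventually_gt_at_top[of 0] by eventually_elim simp
  ultimately show ?thesis by (auto dest: Lim_transform_eventually)
qed

text \<open>Squeezed between the two exponential bounds on \<open>empty_prob\<close>. They differ by
  \<open>exp (- 2 * t ^ 2 / N)\<close>, which tends to 1 because for fixed \<open>k\<close> the
  exponent \<open>t\<close> grows like \<open>k * ln n\<close>.\<close>

lemma tendsto_binomial_empty_prob_crit:
  fixes b c :: real
  shows "(\<lambda>n. real (n choose k) * empty_prob (n choose 2) (real k * (real n - b) * crit c n)) \<longlonglongrightarrow>
    exp (- c) ^ k / fact k"
proof (rule tendsto_sandwich)
  let ?t = "\<lambda>n. real k * (real n - b) * crit c n"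
  let ?N = "\<lambda>n. real n * (real n - 1) / 2"
  show "\<forall>\<^sub>F n in sequentially. real (n choose k) * empty_prob (n choose 2) (?t n) \<le> real (n choose k) * exp (- ?t n)"
    using eventually_ge_at_top[of 2]
    by eventually_elim (auto intro!: mult_left_mono empty_prob_le_exp simp: zero_less_binomial_iff)
  have "\<forall>\<^sub>F n in sequentially. 0 \<le> (real n - b) * crit c n"
    unfolding crit_def by real_asymp
  moreover have lim: "(\<lambda>n. (real n - b) * crit c n / ?N n) \<longlonglongrightarrow> 0"
      "(\<lambda>n. ((real n - b) * crit c n)\<^sup>2 / ?N n) \<longlonglongrightarrow> 0"
    unfolding crit_def by real_asymp+
  have "(\<lambda>n. 2 * real k * ((real n - b) * crit c n / ?N n)) \<longlonglongrightarrow> 2 * real k * 0"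
    by (intro tendsto_intros lim)
  then have "\<forall>\<^sub>F n in sequentially. 2 * real k * ((real n - b) * crit c n / ?N n) < 1"
    by (rule order_tendstoD) simp
  ultimately show "\<forall>\<^sub>F n in sequentially. real (n choose k) * exp (- ?t n) *
      exp (- 2 * (real k)\<^sup>2 * (((real n - b) * crit c n)\<^sup>2 / ?N n)) \<le>
      real (n choose k) * empty_prob (n choose 2) (?t n)"
    using eventually_ge_at_top[of 2]
  proof eventually_elim
    case (elim n)
    have t: "0 \<le> ?t n" using elim by (simp add: mult.assoc)
    have "2 * ?t n \<le> real (n choose 2)"
      using elim by (simp add: real_choose_2 field_simps)
    then have "exp (- ?t n - 2 * (?t n)\<^sup>2 / real (n choose 2)) \<le> empty_prob (n choose 2) (?t n)"
      by (rule empty_prob_ge_exp[OF t])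
    also have "- ?t n - 2 * (?t n)\<^sup>2 / real (n choose 2) =
        - ?t n + - 2 * (real k)\<^sup>2 * (((real n - b) * crit c n)\<^sup>2 / ?N n)"
      by (simp add: real_choose_2 power_mult_distrib)
    finally show ?case
      unfolding exp_add mult.assoc by (intro mult_left_mono) (simp_all add: mult.assoc)
  qed
  have "(\<lambda>n. real (n choose k) * exp (- ?t n) *
      exp (- 2 * (real k)\<^sup>2 * (((real n - b) * crit c n)\<^sup>2 / ?N n))) \<longlonglongrightarrow>
      exp (- c) ^ k / fact k * exp (- 2 * (real k)\<^sup>2 * 0)"
    by (intro tendsto_mult tendsto_exp tendsto_const lim tendsto_binomial_exp_crit)
  then show "(\<lambda>n. real (n choose k) * exp (- ?t n) *
      exp (- 2 * (real k)\<^sup>2 * (((real n - b) * crit c n)\<^sup>2 / ?N n))) \<longlonglongrightarrow> exp (- c) ^ k / fact k"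
    by simp
  show "(\<lambda>n. real (n choose k) * exp (- ?t n)) \<longlonglongrightarrow> exp (- c) ^ k / fact k"
    by (rule tendsto_binomial_exp_crit)
qed

lemma eventually_crit_nonneg: "\<forall>\<^sub>F n in sequentially. 0 \<le> crit c n"
  unfolding crit_def by real_asymp

text \<open>The termwise limits form the exponential series at \<open>- exp (- c)\<close>: the
  probability that a Poisson variable of mean \<open>exp (- c)\<close> is 0.\<close>

lemma tendsto_no_isolated_sum:
  "(\<lambda>n. \<Sum>k\<le>n. real (n choose k) *
    ((- 1) ^ k * empty_prob (n choose 2) (real k * (real n - (real k + 1) / 2) * crit c n)))
    \<longlonglongrightarrow> exp (- exp (- c))"
proof -
  define a where "a k n = real (n choose k) *
    ((- 1) ^ k * empty_prob (n choose 2) (real k * (real n - (real k + 1) / 2) * crit c n))" for k n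
  have lim: "a k \<longlonglongrightarrow> (- 1) ^ k * (exp (- c) ^ k / fact k)" for k
    using tendsto_mult[OF tendsto_const[of "(- 1) ^ k"] tendsto_binomial_empty_prob_crit[of k "(real k + 1) / 2" c]]
    by (simp add: a_def[abs_def] mult.left_commute)
  obtain n0 where n0: "\<And>n k m. n0 \<le> n \<Longrightarrow> n0 \<le> k \<Longrightarrow> 0 \<le> m \<Longrightarrow> m \<le> real k \<Longrightarrow> 2 * m \<le> real n \<Longrightarrow>
      real (n choose k) * exp (- (real k * (real n - m - 1) * crit c n)) \<le> (1 / 2) ^ k"
    using binomial_exp_dominated[of "1 / 2" c] by auto
  obtain n1 where n1: "\<And>n. n1 \<le> n \<Longrightarrow> 0 \<le> crit c n"
    using eventually_crit_nonneg[of c] unfolding eventually_sequentially by blast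
  have bound: "norm (a k n) \<le> (1 / 2) ^ k" if n: "max 2 (max n0 n1) \<le> n" and k: "max 2 (max n0 n1) \<le> k" for n k
  proof (cases "k \<le> n")
    case True
    have "0 < n choose 2" using n by (simp add: zero_less_binomial_iff)
    then have "empty_prob (n choose 2) (real k * (real n - (real k + 1) / 2) * crit c n) \<le>
        exp (- (real k * (real n - (real k + 1) / 2) * crit c n))"
      by (rule empty_prob_le_exp)
    \<comment> \<open>As \<open>(k + 1) / 2 \<le> k / 2 + 1\<close>, this is the dominated form with
      \<open>m = k / 2\<close>, and \<open>2 * m \<le> n\<close> reads
      \<open>k \<le> n\<close>.\<close>
    also have "\<dots> \<le> exp (- (real k * (real n - real k / 2 - 1) * crit c n))"
    proof -
      have "real k * (real n - real k / 2 - 1) * crit c n \<le> real k * (real n - (real k + 1) / 2) * crit c n"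
        using n1[of n] n by (intro mult_right_mono mult_left_mono) (auto simp: field_simps)
      then show ?thesis by simp
    qed
    finally have "norm (a k n) \<le> real (n choose k) * exp (- (real k * (real n - real k / 2 - 1) * crit c n))"
      by (simp add: a_def abs_mult power_abs mult_left_mono)
    also have "\<dots> \<le> (1 / 2) ^ k" using n k True by (intro n0) auto
    finally show ?thesis .
  qed (simp add: a_def binomial_eq_0)
  have "(\<lambda>n. \<Sum>k. a k n) \<longlonglongrightarrow> (\<Sum>k. (- 1) ^ k * (exp (- c) ^ k / fact k))"
  proof (rule tannerys_theorem[THEN conjunct2, THEN conjunct2])
    show "\<forall>\<^sub>F (k, n) in sequentially \<times>\<^sub>F sequentially. norm (a k n) \<le> (1 / 2) ^ k"
      unfolding eventually_prod_sequentially prod.case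
      using bound by (intro exI[of _ "max 2 (max n0 n1)"] allI impI)
    show "summable (\<lambda>k. (1 / 2) ^ k :: real)" by (rule summable_geometric) simp
  qed (use lim in auto)
  also have "(\<Sum>k. (- 1) ^ k * (exp (- c) ^ k / fact k)) = exp (- exp (- c))"
    using sums_unique[OF exp_converges[of "- exp (- c)"]]
    by (simp add: power_minus[of "exp (- c)"] divide_inverse mult_ac)
  also have "(\<lambda>n. \<Sum>k. a k n) = (\<lambda>n. \<Sum>k\<le>n. a k n)"
    by (intro ext suminf_finite) (auto simp: a_def binomial_eq_0)
  finally show ?thesis by (simp add: a_def)
qed

text \<open>For fixed \<open>k\<close> the binomial part converges and the factor
  \<open>crit c n\<close> sends the term to 0. Domination uses the ratio 1/8, which absorbs
  \<open>k * k \<le> 4 ^ k\<close> and leaves the summable \<open>(1 / 2) ^ k\<close>.\<close>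

lemma tendsto_component_sum:
  "(\<lambda>n. \<Sum>k | k \<le> n \<and> 2 \<le> k \<and> 2 * k \<le> n. real (n choose k) *
      (real k * real k * (2 * crit c n) * exp (- (real k * (real n - real k) * crit c n)))) \<longlonglongrightarrow> 0"
proof -
  define a where "a k n = (if k \<le> n \<and> 2 \<le> k \<and> 2 * k \<le> n then real (n choose k) *
      (real k * real k * (2 * crit c n) * exp (- (real k * (real n - real k) * crit c n))) else 0)" for k n
  have crit0: "crit c \<longlonglongrightarrow> 0" unfolding crit_def by real_asymp
  have lim: "a k \<longlonglongrightarrow> 0" for k
  proof -
    let ?b = "\<lambda>n. real k * real k * (2 * crit c n) * (real (n choose k) * exp (- (real k * (real n - real k) * crit c n)))"
    have "?b \<longlonglongrightarrow> real k * real k * (2 * 0) * (exp (- c) ^ k / fact k)"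
      by (intro tendsto_mult tendsto_const crit0 tendsto_binomial_exp_crit)
    then have "?b \<longlonglongrightarrow> 0" by simp
    then show ?thesis
      by (rule tendsto_0_le[where K = 1]) (auto simp: a_def abs_mult mult_ac)
  qed
  obtain n0 where n0: "\<And>n k m. n0 \<le> n \<Longrightarrow> n0 \<le> k \<Longrightarrow> 0 \<le> m \<Longrightarrow> m \<le> real k \<Longrightarrow> 2 * m \<le> real n \<Longrightarrow>
      real (n choose k) * exp (- (real k * (real n - m - 1) * crit c n)) \<le> (1 / 8) ^ k"
    using binomial_exp_dominated[of "1 / 8" c] by auto
  have "\<forall>\<^sub>F n in sequentially. crit c n < 1" using crit0 by (rule order_tendstoD) simp
  with eventually_crit_nonneg[of c] have "\<forall>\<^sub>F n in sequentially. 0 \<le> crit c n \<and> crit c n \<le> 1"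
    by eventually_elim simp
  then obtain n1 where n1: "\<And>n. n1 \<le> n \<Longrightarrow> 0 \<le> crit c n \<and> crit c n \<le> 1"
    unfolding eventually_sequentially by blast
  have bound: "norm (a k n) \<le> 2 * (1 / 2) ^ k" if n: "max n0 n1 \<le> n" and k: "max n0 n1 \<le> k" for n k
  proof (cases "k \<le> n \<and> 2 \<le> k \<and> 2 * k \<le> n")
    case True
    have p: "0 \<le> crit c n" "crit c n \<le> 1" using n1 n by auto
    have "real k \<le> 2 ^ k" by (rule less_imp_le[OF of_nat_less_two_power])
    then have k4: "real k * real k \<le> 2 ^ k * 2 ^ k" by (intro mult_mono) auto
    have "real k * (real n - real k - 1) * crit c n \<le> real k * (real n - real k) * crit c n"
      using p by (intro mult_right_mono mult_left_mono) auto
    then have "real (n choose k) * exp (- (real k * (real n - real k) * crit c n)) \<le>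
        real (n choose k) * exp (- (real k * (real n - real k - 1) * crit c n))"
      by (intro mult_left_mono) auto
    also have "\<dots> \<le> (1 / 8) ^ k" using True n k by (intro n0) auto
    finally have e: "real (n choose k) * exp (- (real k * (real n - real k) * crit c n)) \<le> (1 / 8) ^ k" .
    have "norm (a k n) = real k * real k * (2 * crit c n) *
        (real (n choose k) * exp (- (real k * (real n - real k) * crit c n)))"
      using True p by (simp add: a_def abs_mult)
    also have "\<dots> \<le> 2 ^ k * 2 ^ k * (2 * 1) * (1 / 8) ^ k"
      using e p by (intro mult_mono k4) auto
    also have "\<dots> = 2 * (2 * 2 * (1 / 8)) ^ k"
      by (simp only: power_mult_distrib mult_ac)
    finally show ?thesis by simp
  qed (auto simp: a_def)
  have "(\<lambda>n. \<Sum>k. a k n) \<longlonglongrightarrow> (\<Sum>k. 0)"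
  proof (rule tannerys_theorem[THEN conjunct2, THEN conjunct2])
    show "\<forall>\<^sub>F (k, n) in sequentially \<times>\<^sub>F sequentially. norm (a k n) \<le> 2 * (1 / 2) ^ k"
      unfolding eventually_prod_sequentially prod.case
      using bound by (intro exI[of _ "max n0 n1"] allI impI)
    show "summable (\<lambda>k. 2 * (1 / 2) ^ k :: real)" by (intro summable_mult summable_geometric) simp
  qed (use lim in auto)
  moreover have "(\<Sum>k. a k n) = (\<Sum>k | k \<le> n \<and> 2 \<le> k \<and> 2 * k \<le> n. real (n choose k) *
      (real k * real k * (2 * crit c n) * exp (- (real k * (real n - real k) * crit c n))))" for n
  proof -
    have "(\<Sum>k. a k n) = (\<Sum>k | k \<le> n \<and> 2 \<le> k \<and> 2 * k \<le> n. a k n)"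
      by (intro suminf_finite) (auto simp: a_def)
    then show ?thesis by (simp add: a_def)
  qed
  ultimately show ?thesis by simp
qed

section \<open>The threshold\<close>

text \<open>Having no isolated vertex is implied by connectedness, and the two probabilities differ
  by at most the vanishing component sum.\<close>

lemma tendsto_prob_connected_unit:
  assumes "\<And>n. simplex_graph n (\<alpha> n) \<or> n < 2" "\<And>n e. e \<in> edge_set n \<Longrightarrow> \<alpha> n e = 1"
  shows "(\<lambda>n. prob_connected n (\<alpha> n) (crit c n)) \<longlonglongrightarrow> exp (- exp (- c))"
proof (rule tendsto_sandwich)
  let ?iso = "\<lambda>n. \<Sum>k\<le>n. real (n choose k) *
    ((- 1) ^ k * empty_prob (n choose 2) (real k * (real n - (real k + 1) / 2) * crit c n))"
  let ?comp = "\<lambda>n. \<Sum>k | k \<le> n \<and> 2 \<le> k \<and> 2 * k \<le> n. real (n choose k) *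
      (real k * real k * (2 * crit c n) * exp (- (real k * (real n - real k) * crit c n)))"
  have unit: "unit_graph n (\<alpha> n)" if "2 \<le> n" for n
    using assms(1)[of n] assms(2) that by (auto simp: unit_graph_def unit_graph_axioms_def)
  have "\<forall>\<^sub>F n in sequentially. 2 * crit c n \<le> real n * (real n - 1) / 2"
    "\<forall>\<^sub>F n in sequentially. real n * real n * crit c n \<le> real n * (real n - 1)"
    unfolding crit_def by real_asymp+
  then show "\<forall>\<^sub>F n in sequentially. ?iso n - ?comp n \<le> prob_connected n (\<alpha> n) (crit c n)"
    using eventually_crit_nonneg[of c] eventually_ge_at_top[of 2]
  proof eventually_elim
    case (elim n)
    interpret unit_graph n "\<alpha> n" using elim unit by blast
    show ?case
      using prob_no_isolated_le_unit[of "crit c n"] prob_no_isolated_unit[of "crit c n"] elim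
      by (simp add: real_choose_2)
  qed
  show "\<forall>\<^sub>F n in sequentially. prob_connected n (\<alpha> n) (crit c n) \<le> ?iso n"
    using eventually_crit_nonneg[of c] eventually_ge_at_top[of 2]
  proof eventually_elim
    case (elim n)
    interpret unit_graph n "\<alpha> n" using elim unit by blast
    show ?case
      using prob_connected_le_no_isolated[of "crit c n"] prob_no_isolated_unit[of "crit c n"] elim by simp
  qed
  show "(\<lambda>n. ?iso n - ?comp n) \<longlonglongrightarrow> exp (- exp (- c))"
    using tendsto_diff[OF tendsto_no_isolated_sum[of c] tendsto_component_sum[of c]] by simp
  show "?iso \<longlonglongrightarrow> exp (- exp (- c))" by (rule tendsto_no_isolated_sum)
qed

text \<open>The \<open>large_\<close> assumptions are phrased in \<open>n\<close> alone, with
  \<open>M\<close> already replaced by its bound, so they are plain asymptotic facts, uniform in the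
  weights.\<close>

lemma eventually_bounded_graph:
  assumes "\<And>n e. e \<in> edge_set n \<Longrightarrow> 0 < \<alpha> n e"
    and "\<forall>\<^sub>F n in sequentially. M_bounded (M n) n (\<alpha> n) \<and> M n \<le> ln (real n) powr (1 / 4)"
  shows "\<forall>\<^sub>F n in sequentially. bounded_graph n (\<alpha> n) (M n)"
proof -
  have 1: "\<forall>\<^sub>F n in sequentially. real n * exp (- (real n * (real n - 1) / 2) / sqrt (ln (real n))) \<le> 1"
    by real_asymp
  have 2: "\<forall>\<^sub>F n in sequentially. 4 * (ln (real n) * sqrt (ln (real n))) \<le> real n * (real n - 1) / 2"
    by real_asymp
  have "((\<lambda>n. exp (- 2 * (ln (real n) * sqrt (ln (real n)))\<^sup>2 / (real n * (real n - 1) / 2))) \<longlongrightarrow> 1) sequentially"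
    by real_asymp
  then have 3: "\<forall>\<^sub>F n in sequentially. 1 / 2 <
      exp (- 2 * (ln (real n) * sqrt (ln (real n)))\<^sup>2 / (real n * (real n - 1) / 2))"
    by (rule order_tendstoD) simp
  have "((\<lambda>n. exp (- sqrt (ln (real n)) / 8) * (2 * (ln (real n) * sqrt (ln (real n)))) *
      (real n / (real n - 1))) \<longlongrightarrow> 0) sequentially"
    by real_asymp
  then have 4: "\<forall>\<^sub>F n in sequentially. exp (- sqrt (ln (real n)) / 8) *
      (2 * (ln (real n) * sqrt (ln (real n)))) * (real n / (real n - 1)) < 1"
    by (rule order_tendstoD) simp
  show ?thesis
    using assms(2) 1 2 3 4 eventually_ge_at_top[of 2]
  proof eventually_elim
    case (elim n)
    then show ?case
      using assms(1) by unfold_locales (auto simp: real_choose_2)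
  qed
qed

lemma tendsto_prob_connected_below:
  assumes "\<forall>\<^sub>F n in sequentially. bounded_graph n (\<alpha> n) (M n)" "0 < \<epsilon>"
    and p: "\<forall>\<^sub>F n in sequentially. p n \<le> (1 - \<epsilon>) * p0 n (\<alpha> n)"
  shows "(\<lambda>n. prob_connected n (\<alpha> n) (p n)) \<longlonglongrightarrow> 0"
proof -
  \<comment> \<open>\<open>prob_connected_below\<close> asks for a value below 1; monotonicity in
    \<open>p\<close> and \<open>p0 \<ge> 0\<close> allow \<epsilon> to be reduced.\<close>
  define \<delta> where "\<delta> = min \<epsilon> (1 / 2)"
  have \<delta>: "0 < \<delta>" "\<delta> < 1" "\<delta> \<le> \<epsilon>" using assms(2) by (auto simp: \<delta>_def)
  have up: "\<forall>\<^sub>F n in sequentially. prob_connected n (\<alpha> n) (p n) \<le>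
      2 * exp (- (\<delta> * lam n)) + exp (2 * (ln (real n) * sqrt (ln (real n)) / (real n - 1))) - 1"
    using assms(1) p
  proof eventually_elim
    case (elim n)
    interpret bounded_graph n "\<alpha> n" "M n" by fact
    have "(1 - \<epsilon>) * p0 n (\<alpha> n) \<le> (1 - \<delta>) * p0 n (\<alpha> n)"
      using \<delta> p0_nonneg by (intro mult_right_mono) auto
    then have "prob_connected n (\<alpha> n) (p n) \<le> prob_connected n (\<alpha> n) ((1 - \<delta>) * p0 n (\<alpha> n))"
      using elim(2) by (intro prob_connected_mono) linarith
    then show ?case using prob_connected_below[OF \<delta>(1,2)] by linarith
  qed
  have lo: "\<forall>\<^sub>F n in sequentially. 0 \<le> prob_connected n (\<alpha> n) (p n)"
    by (simp add: prob_connected_def)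
  have "(\<lambda>n. 2 * exp (- (\<delta> * lam n)) + exp (2 * (ln (real n) * sqrt (ln (real n)) / (real n - 1))) - 1) \<longlonglongrightarrow> 0"
    unfolding lam_def using \<delta> by real_asymp
  then show ?thesis by (rule tendsto_sandwich[OF lo up tendsto_const])
qed

lemma tendsto_prob_connected_above:
  assumes "\<forall>\<^sub>F n in sequentially. bounded_graph n (\<alpha> n) (M n)" "0 < \<epsilon>"
    and p: "\<forall>\<^sub>F n in sequentially. (1 + \<epsilon>) * p0 n (\<alpha> n) \<le> p n"
  shows "(\<lambda>n. prob_connected n (\<alpha> n) (p n)) \<longlonglongrightarrow> 1"
proof -
  \<comment> \<open>Keeps \<open>(1 + \<delta>) * p0\<close> within \<open>2 * p0\<close>, on which
    the choice of \<open>K\<close> in \<open>prob_connected_above\<close> relies; larger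
    \<open>p\<close> follow by monotonicity.\<close>
  define \<delta> where "\<delta> = min \<epsilon> 1"
  have \<delta>: "0 < \<delta>" "\<delta> \<le> 1" "\<delta> \<le> \<epsilon>" using assms(2) by (auto simp: \<delta>_def)
  define \<beta> where "\<beta> n = exp (1 + sqrt (ln (real n)) / 8 - lam n / 2)" for n
  have \<beta>: "\<beta> \<longlonglongrightarrow> 0"
    unfolding \<beta>_def[abs_def] lam_def by real_asymp
  then have \<beta>1: "\<forall>\<^sub>F n in sequentially. \<beta> n < 1" by (rule order_tendstoD) simp
  have lo: "\<forall>\<^sub>F n in sequentially. 1 - (exp (2 * exp 1 * exp (- (\<delta> * lam n))) - 1 + \<beta> n / (1 - \<beta> n)) \<le>
      prob_connected n (\<alpha> n) (p n)"
    using assms(1) p \<beta>1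
  proof eventually_elim
    case (elim n)
    interpret bounded_graph n "\<alpha> n" "M n" by fact
    have "(1 + \<delta>) * p0 n (\<alpha> n) \<le> (1 + \<epsilon>) * p0 n (\<alpha> n)"
      using \<delta> p0_nonneg by (intro mult_right_mono) auto
    then have "prob_connected n (\<alpha> n) ((1 + \<delta>) * p0 n (\<alpha> n)) \<le> prob_connected n (\<alpha> n) (p n)"
      using elim(2) by (intro prob_connected_mono) linarith
    then show ?case using prob_connected_above[OF \<delta>(1,2)] elim(3) unfolding \<beta>_def by fastforce
  qed
  have up: "\<forall>\<^sub>F n in sequentially. prob_connected n (\<alpha> n) (p n) \<le> 1"
    using assms(1)
  proof eventually_elim
    case (elim n)
    interpret bounded_graph n "\<alpha> n" "M n" by fact
    show ?case by (rule prob_connected_bounds)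
  qed
  have "(\<lambda>n. exp (- (\<delta> * lam n))) \<longlonglongrightarrow> 0"
    unfolding lam_def using \<delta> by real_asymp
  then have "(\<lambda>n. 1 - (exp (2 * exp 1 * exp (- (\<delta> * lam n))) - 1 + \<beta> n / (1 - \<beta> n))) \<longlonglongrightarrow>
      1 - (exp (2 * exp 1 * 0) - 1 + 0 / (1 - 0))"
    using \<beta> by (intro tendsto_intros) auto
  then have "(\<lambda>n. 1 - (exp (2 * exp 1 * exp (- (\<delta> * lam n))) - 1 + \<beta> n / (1 - \<beta> n))) \<longlonglongrightarrow> 1" by simp
  then show ?thesis by (rule tendsto_sandwich[OF lo up _ tendsto_const])
qed

lemma prob_connected_crit_le:
  assumes "simplex_graph n \<alpha>" "a \<le> b"
  shows "prob_connected n \<alpha> ((ln (real n) + a) / real n) \<le> prob_connected n \<alpha> ((ln (real n) + b) / real n)"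
proof -
  interpret simplex_graph n \<alpha> by fact
  show ?thesis using assms(2) by (intro prob_connected_mono divide_right_mono) auto
qed

theorem theorem2p5:
  fixes \<alpha> :: "nat \<Rightarrow> nat set \<Rightarrow> real"
  assumes pos: "\<And>n e. e \<in> edge_set n \<Longrightarrow> 0 < \<alpha> n e"
  shows
    "((\<forall>n. \<forall>e\<in>edge_set n. \<alpha> n e = 1) \<longrightarrow>
       (\<forall>c :: nat \<Rightarrow> real.
          let P = (\<lambda>n. prob_connected n (\<alpha> n) ((ln (real n) + c n) / real n)) in
            (filterlim c at_bot sequentially \<longrightarrow> P \<longlonglongrightarrow> 0) \<and>
            (\<forall>l :: real. c \<longlonglongrightarrow> l \<longrightarrow> P \<longlonglongrightarrow> exp (- exp (- l))) \<and>
            (filterlim c at_top sequentially \<longrightarrow> P \<longlonglongrightarrow> 1))) \<and>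
     (\<forall>M :: nat \<Rightarrow> real.
       (\<forall>\<^sub>F n in sequentially. M_bounded (M n) n (\<alpha> n) \<and> M n \<le> ln (real n) powr (1 / 4)) \<longrightarrow>
       (\<forall>\<epsilon> > 0. \<forall>p :: nat \<Rightarrow> real.
          ((\<forall>\<^sub>F n in sequentially. p n \<le> (1 - \<epsilon>) * p0 n (\<alpha> n)) \<longrightarrow>
             (\<lambda>n. prob_connected n (\<alpha> n) (p n)) \<longlonglongrightarrow> 0) \<and>
          ((\<forall>\<^sub>F n in sequentially. p n \<ge> (1 + \<epsilon>) * p0 n (\<alpha> n)) \<longrightarrow>
             (\<lambda>n. prob_connected n (\<alpha> n) (p n)) \<longlonglongrightarrow> 1)))"
proof (intro conjI impI allI)
  fix c :: "nat \<Rightarrow> real"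
  assume unit: "\<forall>n. \<forall>e\<in>edge_set n. \<alpha> n e = 1"
  define P where "P n = prob_connected n (\<alpha> n) ((ln (real n) + c n) / real n)" for n
  have sg: "simplex_graph n (\<alpha> n)" if "2 \<le> n" for n
    using that pos by unfold_locales auto
  have "\<And>n. simplex_graph n (\<alpha> n) \<or> n < 2" using sg not_le by blast
  then have crit: "(\<lambda>n. prob_connected n (\<alpha> n) (crit b n)) \<longlonglongrightarrow> exp (- exp (- b))" for b
    using unit by (intro tendsto_prob_connected_unit) auto
  \<comment> \<open>By monotonicity in \<open>p\<close>, an eventual bound of \<open>c n\<close> by
    a constant \<open>b\<close> compares \<open>P n\<close> with the constant window, whose limit is
    known. All three cases reduce to choosing \<open>b\<close>.\<close>
  have less: "\<forall>\<^sub>F n in sequentially. P n < u"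
    if "\<forall>\<^sub>F n in sequentially. c n \<le> b" "exp (- exp (- b)) < u" for b u
    using that(1) order_tendstoD(2)[OF crit that(2)] eventually_ge_at_top[of 2]
  proof eventually_elim
    case (elim n)
    then show ?case using prob_connected_crit_le[OF sg, of n "c n" b] by (simp add: P_def crit_def)
  qed
  have greater: "\<forall>\<^sub>F n in sequentially. u < P n"
    if "\<forall>\<^sub>F n in sequentially. b \<le> c n" "u < exp (- exp (- b))" for b u
    using that(1) order_tendstoD(1)[OF crit that(2)] eventually_ge_at_top[of 2]
  proof eventually_elim
    case (elim n)
    then show ?case using prob_connected_crit_le[OF sg, of n b "c n"] by (simp add: P_def crit_def)
  qed
  have P0: "0 \<le> P n" for n by (simp add: P_def prob_connected_def)
  have P1: "\<forall>\<^sub>F n in sequentially. P n \<le> 1"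
    using eventually_ge_at_top[of 2]
    by eventually_elim (auto simp: P_def intro!: simplex_graph.prob_connected_bounds sg)
  have lim_bot: "((\<lambda>b. exp (- exp (- b))) \<longlongrightarrow> (0::real)) at_bot" by real_asymp
  have lim_top: "((\<lambda>b. exp (- exp (- b))) \<longlongrightarrow> (1::real)) at_top" by real_asymp
  have "P \<longlonglongrightarrow> 0" if c: "filterlim c at_bot sequentially"
  proof (rule order_tendstoI)
    fix u :: real assume "0 < u"
    then obtain b where "exp (- exp (- b)) < u"
      using order_tendstoD(2)[OF lim_bot, of u] by (auto simp: eventually_at_bot_linorder)
    then show "\<forall>\<^sub>F n in sequentially. P n < u"
      using c by (intro less) (auto simp: filterlim_at_bot)
  next
    fix u :: real assume "u < 0"
    then show "\<forall>\<^sub>F n in sequentially. u < P n" using P0 by (auto intro: less_le_trans always_eventually)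
  qed
  moreover have "P \<longlonglongrightarrow> 1" if c: "filterlim c at_top sequentially"
  proof (rule order_tendstoI)
    fix u :: real assume "u < 1"
    then obtain b where "u < exp (- exp (- b))"
      using order_tendstoD(1)[OF lim_top, of u] by (auto simp: eventually_at_top_linorder)
    then show "\<forall>\<^sub>F n in sequentially. u < P n"
      using c by (intro greater) (auto simp: filterlim_at_top)
  next
    fix u :: real assume "1 < u"
    then show "\<forall>\<^sub>F n in sequentially. P n < u" using P1 by (auto elim!: eventually_mono)
  qed
  moreover have "P \<longlonglongrightarrow> exp (- exp (- l))" if c: "c \<longlonglongrightarrow> l" for l
  proof (rule order_tendstoI)
    have cont: "((\<lambda>b. exp (- exp (- b))) \<longlongrightarrow> exp (- exp (- l))) F" if "((\<lambda>b. b) \<longlongrightarrow> l) F" for F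
      using that by (intro tendsto_intros)
    \<comment> \<open>By continuity some \<open>b\<close> slightly above \<open>l\<close> still has
      its limit value below \<open>u\<close>, and \<open>c n\<close> is eventually below
      \<open>b\<close>.\<close>
    fix u assume "exp (- exp (- l)) < u"
    with order_tendstoD(2)[OF cont, of "at_right l" u]
    have "\<forall>\<^sub>F b in at_right l. exp (- exp (- b)) < u" by simp
    with eventually_at_right_less[of l] have "\<forall>\<^sub>F b in at_right l. l < b \<and> exp (- exp (- b)) < u"
      by eventually_elim auto
    then obtain b where b: "l < b" "exp (- exp (- b)) < u"
      using eventually_happens[of _ "at_right l"] by (auto simp: trivial_limit_at_right_real)
    have "\<forall>\<^sub>F n in sequentially. c n \<le> b"
      using order_tendstoD(2)[OF c b(1)] by eventually_elim simp
    then show "\<forall>\<^sub>F n in sequentially. P n < u" using b(2) by (rule less)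
  next
    have cont: "((\<lambda>b. exp (- exp (- b))) \<longlongrightarrow> exp (- exp (- l))) F" if "((\<lambda>b. b) \<longlongrightarrow> l) F" for F
      using that by (intro tendsto_intros)
    fix u assume "u < exp (- exp (- l))"
    with order_tendstoD(1)[OF cont, of "at_left l" u]
    have "\<forall>\<^sub>F b in at_left l. u < exp (- exp (- b))" by simp
    moreover have "\<forall>\<^sub>F b in at_left l. b < l"
      by (rule eventually_at_leftI[of "l - 1"]) auto
    ultimately have "\<forall>\<^sub>F b in at_left l. b < l \<and> u < exp (- exp (- b))"
      by eventually_elim auto
    then obtain b where b: "b < l" "u < exp (- exp (- b))"
      using eventually_happens[of _ "at_left l"] by (auto simp: trivial_limit_at_left_real)
    have "\<forall>\<^sub>F n in sequentially. b \<le> c n"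
      using order_tendstoD(1)[OF c b(1)] by eventually_elim simp
    then show "\<forall>\<^sub>F n in sequentially. u < P n" using b(2) by (rule greater)
  qed
  ultimately show "let P = (\<lambda>n. prob_connected n (\<alpha> n) ((ln (real n) + c n) / real n)) in
      (filterlim c at_bot sequentially \<longrightarrow> P \<longlonglongrightarrow> 0) \<and>
      (\<forall>l :: real. c \<longlonglongrightarrow> l \<longrightarrow> P \<longlonglongrightarrow> exp (- exp (- l))) \<and>
      (filterlim c at_top sequentially \<longrightarrow> P \<longlonglongrightarrow> 1)"
    unfolding Let_def P_def[abs_def, symmetric] by blast
next
  fix M p :: "nat \<Rightarrow> real" and \<epsilon> :: real
  assume "\<forall>\<^sub>F n in sequentially. M_bounded (M n) n (\<alpha> n) \<and> M n \<le> ln (real n) powr (1 / 4)" and \<epsilon>: "0 < \<epsilon>"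
  then have bg: "\<forall>\<^sub>F n in sequentially. bounded_graph n (\<alpha> n) (M n)"
    using pos by (intro eventually_bounded_graph)
  show "(\<lambda>n. prob_connected n (\<alpha> n) (p n)) \<longlonglongrightarrow> 0"
    if "\<forall>\<^sub>F n in sequentially. p n \<le> (1 - \<epsilon>) * p0 n (\<alpha> n)"
    using bg \<epsilon> that by (rule tendsto_prob_connected_below)
  show "(\<lambda>n. prob_connected n (\<alpha> n) (p n)) \<longlonglongrightarrow> 1"
    if "\<forall>\<^sub>F n in sequentially. (1 + \<epsilon>) * p0 n (\<alpha> n) \<le> p n"
    using bg \<epsilon> that by (rule tendsto_prob_connected_above)
qed

end
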